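(* Let $k$ be an infinite field with $\operatorname{char} k \neq 2$ which is not algebraically closed. Let $a,b,c,d\in k$ with $a\in k\setminus k^2$, $b\neq 0$, and at least one of $c,d$ non-zero. Let $L_0=k(t_1,t_2,t_3,t_4)$ be a field extension of $k$ with $\operatorname{trdeg}_k(L_0)=2$ whose generators satisfy \[ t_1^2-at_2^2=b,\qquad t_3^2-at_4^2=2ct_1+d. \] Assume that $b\in k\setminus k^2$. Then the following statements are equivalent: (i) $L_0$ is $k$-rational; (ii) $L_0$ is stably $k$-rational; (iii) $L_0$ is $k$-unirational; (iv) there exist $\alpha,\beta,\gamma,\delta\in k$ with $\alpha^2-a\beta^2=b$ and $\gamma^2-a\delta^2=2c\alpha+d$; (v) there exist $\alpha,\beta\in k$ such that (v-1) $\alpha^2-a\beta^2=b$, and (v-2) either $-2c\alpha+d=0$, or $-2c\alpha+d\neq 0$ and $(a,-2c\alpha+d)_{2,k(\sqrt{d^2-4bc^2})}=0$; (vi) (vi-1) $(a,b)_{2,k}=0$, and (vi-2) for any $\alpha,\beta\in k$ with $\alpha^2-a\beta^2=b$, either $-2c\alpha+d=0$, or $-2c\alpha+d\neq 0$ and $(a,-2c\alpha+d)_{2,k(\sqrt{d^2-4bc^2})}=0$.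
   Context: A finitely generated field extension $L/k$ is $k$-rational if it is purely transcendental over $k$; stably $k$-rational if $L(y_1,\dots,y_m)$ is $k$-rational for some elements $y_1,\dots,y_m$ algebraically independent over $L$; $k$-unirational if $L$ is $k$-isomorphic to a subfield of a $k$-rational field. For a field $F$ with $\operatorname{char}F\neq 2$ and non-zero $u,v\in F$, $(u,v)_{2,F}$ denotes the class in the Brauer group $\mathrm{Br}(F)$ of the quaternion algebra generated over $F$ by $U,V$ with $U^2=u$, $V^2=v$, $UV=-VU$ (Hilbert symbol); $(u,v)_{2,F}=0$ if and only if there exist $x,y\in F$ with $ux^2+vy^2=1$. *)

theory Defs
  imports "HOL-Library.Poly_Mapping" "HOL-Computational_Algebra.Fraction_Field"
          "HOL-Computational_Algebra.Polynomial"
begin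

definition field_hom :: "('a::field \<Rightarrow> 'b::field) \<Rightarrow> bool" where
  "field_hom f \<longleftrightarrow> f 1 = 1 \<and> (\<forall>x y. f (x + y) = f x + f y) \<and> (\<forall>x y. f (x * y) = f x * f y)"

definition is_subfield :: "'a::field set \<Rightarrow> bool" where
  "is_subfield S \<longleftrightarrow> 0 \<in> S \<and> 1 \<in> S \<and> (\<forall>x\<in>S. \<forall>y\<in>S. x + y \<in> S \<and> x * y \<in> S)
     \<and> (\<forall>x\<in>S. - x \<in> S \<and> inverse x \<in> S)"

definition gen_field :: "'a::field set \<Rightarrow> 'a set" where
  "gen_field A = \<Inter> {S. A \<subseteq> S \<and> is_subfield S}"

text \<open>Multivariate polynomials are finitely supported maps from monomials (exponent vectors)
  to coefficients; evaluation at a point x.\<close>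
definition mpoly_eval :: "((nat \<Rightarrow>\<^sub>0 nat) \<Rightarrow>\<^sub>0 'a::field) \<Rightarrow> (nat \<Rightarrow> 'a) \<Rightarrow> 'a" where
  "mpoly_eval p x = (\<Sum>mon\<in>Poly_Mapping.keys p. Poly_Mapping.lookup p mon * (\<Prod>j\<in>Poly_Mapping.keys mon. x j ^ Poly_Mapping.lookup (mon :: nat \<Rightarrow>\<^sub>0 nat) j))"

definition alg_indep :: "'a::field set \<Rightarrow> (nat \<Rightarrow> 'a) \<Rightarrow> nat \<Rightarrow> bool" where
  "alg_indep K x n \<longleftrightarrow>
     (\<forall>p. (\<forall>mon\<in>Poly_Mapping.keys p. Poly_Mapping.lookup p mon \<in> K \<and> Poly_Mapping.keys (mon :: nat \<Rightarrow>\<^sub>0 nat) \<subseteq> {..<n}) \<and> mpoly_eval p x = 0 \<longrightarrow> p = 0)"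

definition trdeg_eq :: "'a::field set \<Rightarrow> 'a set \<Rightarrow> nat \<Rightarrow> bool" where
  "trdeg_eq K E n \<longleftrightarrow>
     (\<exists>x. (\<forall>j<n. x j \<in> E) \<and> alg_indep K x n) \<and>
     (\<forall>m x. (\<forall>j<m. x j \<in> E) \<and> alg_indep K x m \<longrightarrow> m \<le> n)"

definition rational_over :: "'a::field set \<Rightarrow> 'a set \<Rightarrow> bool" where
  "rational_over K E \<longleftrightarrow>
     (\<exists>n x. (\<forall>j<n. x j \<in> E) \<and> alg_indep K x n \<and> gen_field (K \<union> x ` {..<n}) = E)"

type_synonym 'a ratfun = "((nat \<Rightarrow>\<^sub>0 nat) \<Rightarrow>\<^sub>0 'a) fract"

definition rf_const :: "'a::field \<Rightarrow> 'a ratfun" where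
  "rf_const c = Fraction_Field.Fract (Poly_Mapping.single 0 c) 1"

definition rf_var :: "nat \<Rightarrow> 'a::field ratfun" where
  "rf_var j = Fraction_Field.Fract (Poly_Mapping.single (Poly_Mapping.single j 1) 1) 1"

definition rf_field :: "nat \<Rightarrow> 'a::field ratfun set" where
  "rf_field m = gen_field (range rf_const \<union> rf_var ` {..<m})"

definition hilbert_zero :: "'a::field \<Rightarrow> 'a \<Rightarrow> bool" where
  "hilbert_zero u v \<longleftrightarrow> (\<exists>x y. u * x\<^sup>2 + v * y\<^sup>2 = 1)"

text \<open>Arithmetic in k(sqrt e) = k[s]/(s^2 - e) for non-square e: a pair (p,q) stands for p + q s.\<close>
definition sq_mult :: "'a::field \<Rightarrow> 'a \<times> 'a \<Rightarrow> 'a \<times> 'a \<Rightarrow> 'a \<times> 'a" where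
  "sq_mult e z w = (fst z * fst w + e * snd z * snd w, fst z * snd w + snd z * fst w)"

definition sq_add :: "'a::field \<times> 'a \<Rightarrow> 'a \<times> 'a \<Rightarrow> 'a \<times> 'a" where
  "sq_add z w = (fst z + fst w, snd z + snd w)"

text \<open>(u,v)_{2,k(sqrt e)} = 0 for u, v in k. If e is a square in k, then k(sqrt e) = k.\<close>
definition hilbert_zero_sqrt :: "'a::field \<Rightarrow> 'a \<Rightarrow> 'a \<Rightarrow> bool" where
  "hilbert_zero_sqrt e u v \<longleftrightarrow>
     (if \<exists>r. r\<^sup>2 = e then hilbert_zero u v
      else (\<exists>x y. sq_add (sq_mult e (u, 0) (sq_mult e x x)) (sq_mult e (v, 0) (sq_mult e y y)) = (1, 0)))"

end

theory Submission
  imports Defs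
begin

text \<open>
  Put \<open>N(x, y) = x\<^sup>2 - a y\<^sup>2\<close> and \<open>e = d\<^sup>2 - 4 b c\<^sup>2\<close>. Parametrizing the conic \<open>N = b\<close> from its
  point \<open>(\<alpha>, \<beta>)\<close> turns \<open>2 c t1 + d\<close>, up to a norm, into a binary quadratic form \<open>q\<close>, and
  \<open>(d - 2 c \<alpha>) q(s, v) = P\<^sup>2 - a e s\<^sup>2\<close> with \<open>P\<close> linear in \<open>s, v\<close>. So (iv) says that the quaternary form
  \<open>P\<^sup>2 - a e s\<^sup>2 - (d - 2 c \<alpha>) N(g, h)\<close> of discriminant \<open>e\<close> is isotropic, which is equivalent to its
  isotropy over \<open>k(\<surd>e)\<close>, that is, to the vanishing of the Hilbert symbol in (v) and (vi), for any
  choice of \<open>(\<alpha>, \<beta>)\<close>. A rational point moreover allows one to project the quadric surface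
  \<open>X\<^sup>2 - a Y\<^sup>2 = q(s, 1)\<close>, whose function field is \<open>L\<^sub>0\<close>, onto a plane, which gives (i). Conversely,
  (i) implies (ii) implies (iii) formally, and (iii) implies (iv) by specializing rational functions
  at a point of the infinite field \<open>k\<close> where the denominators do not vanish.
\<close>

subsection \<open>The quaternary form and rational points\<close>

lemma norm_form_eq_0D:
  fixes a x y :: "'k::field"
  assumes "\<not> (\<exists>r. r\<^sup>2 = a)" "x\<^sup>2 - a * y\<^sup>2 = 0"
  shows "x = 0 \<and> y = 0"
proof (rule ccontr)
  assume "\<not> ?thesis"
  with assms(2) have "y \<noteq> 0" by auto
  hence "(x / y)\<^sup>2 = a" using assms(2) by (simp add: power_divide)
  with assms(1) show False by blast
qed

text \<open>Multiplicativity of the norm from k(sqrt a): the two terms on the left are the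
  coordinates of (g + h sqrt a) / (v + s sqrt a).\<close>

lemma norm_form_divide:
  fixes a g h v s :: "'k::field"
  assumes "v\<^sup>2 - a * s\<^sup>2 \<noteq> 0"
  shows "((g * v - a * h * s) / (v\<^sup>2 - a * s\<^sup>2))\<^sup>2 - a * ((h * v - g * s) / (v\<^sup>2 - a * s\<^sup>2))\<^sup>2
           = (g\<^sup>2 - a * h\<^sup>2) / (v\<^sup>2 - a * s\<^sup>2)"
proof -
  have "(g * v - a * h * s)\<^sup>2 - a * (h * v - g * s)\<^sup>2 = (g\<^sup>2 - a * h\<^sup>2) * (v\<^sup>2 - a * s\<^sup>2)"
    by algebra
  with assms show ?thesis
    by (simp add: power_divide diff_divide_distrib[symmetric] power2_eq_square[of "v\<^sup>2 - a * s\<^sup>2"])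
qed

text \<open>The line through (\<alpha>, \<beta>) in direction (v, s) meets the conic in a second
  point, whose value of 2 c t1 + d is N(g, h) / N(v, s) and hence a norm.\<close>

lemma rational_point_of_isotropic:
  fixes a b c d \<alpha> \<beta> P s g h :: "'k::field"
  assumes a: "\<not> (\<exists>r. r\<^sup>2 = a)" and ab: "\<alpha>\<^sup>2 - a * \<beta>\<^sup>2 = b" and S: "d - 2 * c * \<alpha> \<noteq> 0"
    and iso: "P\<^sup>2 - a * (d\<^sup>2 - 4 * b * c\<^sup>2) * s\<^sup>2 = (d - 2 * c * \<alpha>) * (g\<^sup>2 - a * h\<^sup>2)"
    and nz: "P \<noteq> 0 \<or> s \<noteq> 0"
  shows "\<exists>\<alpha> \<beta> \<gamma> \<delta>. \<alpha>\<^sup>2 - a * \<beta>\<^sup>2 = b \<and> \<gamma>\<^sup>2 - a * \<delta>\<^sup>2 = 2 * c * \<alpha> + d"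
proof -
  define S where "S = d - 2 * c * \<alpha>"
  \<comment> \<open>Inverts P = S v + 2 c a \<beta> s, the linear form obtained by completing the
    square in S q(s, v).\<close>
  define v where "v = (P - 2 * c * a * \<beta> * s) / S"
  define n where "n = v\<^sup>2 - a * s\<^sup>2"
  \<comment> \<open>Parameter of the second intersection of the line (\<alpha> + v k, \<beta> + s k)
    with the conic.\<close>
  define k where "k = (2 * a * \<beta> * s - 2 * \<alpha> * v) / n"
  have S0: "S \<noteq> 0" using S by (simp add: S_def)
  have P: "P = S * v + 2 * c * a * \<beta> * s" using S0 by (simp add: v_def)
  have n0: "n \<noteq> 0"
    using norm_form_eq_0D[OF a, of v s] nz P by (auto simp: n_def)
  have kn: "k * n = 2 * a * \<beta> * s - 2 * \<alpha> * v" using n0 by (simp add: k_def)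
  have "S * (S * v\<^sup>2 + 4 * c * a * \<beta> * s * v - a * (2 * c * \<alpha> + d) * s\<^sup>2) = S * (g\<^sup>2 - a * h\<^sup>2)"
    using iso P ab unfolding S_def by algebra
  hence q: "S * v\<^sup>2 + 4 * c * a * \<beta> * s * v - a * (2 * c * \<alpha> + d) * s\<^sup>2 = g\<^sup>2 - a * h\<^sup>2"
    using S0 by simp
  have 1: "(\<alpha> + v * k)\<^sup>2 - a * (\<beta> + s * k)\<^sup>2 = b"
    using kn ab unfolding n_def by algebra
  have "(2 * c * (\<alpha> + v * k) + d) * n = g\<^sup>2 - a * h\<^sup>2"
    using kn q unfolding n_def S_def by algebra
  hence 2: "(g\<^sup>2 - a * h\<^sup>2) / n = 2 * c * (\<alpha> + v * k) + d" using n0 by (simp add: divide_simps)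
  show ?thesis
    using 1 2 norm_form_divide[OF n0[unfolded n_def], of g h] unfolding n_def by metis
qed

text \<open>Reverses the parametrization: the direction from (\<alpha>, \<beta>) to the given point
  supplies (v, s), and q(s, v) = N(v, s) N(\<gamma>, \<delta>) is again a norm.\<close>

lemma isotropic_of_rational_point:
  fixes a b c d \<alpha> \<beta> :: "'k::field"
  assumes a: "\<not> (\<exists>r. r\<^sup>2 = a)" and b: "b \<noteq> 0"
    and ab: "\<alpha>\<^sup>2 - a * \<beta>\<^sup>2 = b" and S: "d - 2 * c * \<alpha> \<noteq> 0"
    and ab': "\<alpha>'\<^sup>2 - a * \<beta>'\<^sup>2 = b" and gd: "\<gamma>\<^sup>2 - a * \<delta>\<^sup>2 = 2 * c * \<alpha>' + d"
  shows "\<exists>P s g h. (P \<noteq> 0 \<or> s \<noteq> 0) \<and>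
           P\<^sup>2 - a * (d\<^sup>2 - 4 * b * c\<^sup>2) * s\<^sup>2 = (d - 2 * c * \<alpha>) * (g\<^sup>2 - a * h\<^sup>2)"
proof -
  have a0: "a \<noteq> 0" using a by (metis zero_power2)
  obtain v s k where vs: "v \<noteq> 0 \<or> s \<noteq> 0" and al: "\<alpha>' = \<alpha> + v * k" and be: "\<beta>' = \<beta> + s * k"
    and kn: "k * (v\<^sup>2 - a * s\<^sup>2) = 2 * a * \<beta> * s - 2 * \<alpha> * v"
  proof (cases "\<alpha>' = \<alpha> \<and> \<beta>' = \<beta>")
    case True
    have "a * \<beta> \<noteq> 0 \<or> \<alpha> \<noteq> 0" using ab b a0 by auto
    \<comment> \<open>The two points coincide, so the secant is replaced by the tangent direction (a
      \<beta>, \<alpha>) with k = 0.\<close>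
    then show ?thesis using that[of "a * \<beta>" \<alpha> 0] True by simp
  next
    case False
    have "\<alpha>'\<^sup>2 - a * \<beta>'\<^sup>2 = \<alpha>\<^sup>2 - a * \<beta>\<^sup>2" using ab ab' by simp
    hence "(\<alpha>' - \<alpha>)\<^sup>2 - a * (\<beta>' - \<beta>)\<^sup>2 = 2 * a * \<beta> * (\<beta>' - \<beta>) - 2 * \<alpha> * (\<alpha>' - \<alpha>)"
      by algebra
    then show ?thesis using that[of "\<alpha>' - \<alpha>" "\<beta>' - \<beta>" 1] False by auto
  qed
  define S where "S = d - 2 * c * \<alpha>"
  \<comment> \<open>The right-hand side is the norm of (v + s sqrt a) (\<gamma> + \<delta> sqrt
    a).\<close>
  have q: "S * v\<^sup>2 + 4 * c * a * \<beta> * s * v - a * (2 * c * \<alpha> + d) * s\<^sup>2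
             = (v * \<gamma> + a * s * \<delta>)\<^sup>2 - a * (v * \<delta> + s * \<gamma>)\<^sup>2"
    using kn gd al unfolding S_def by algebra
  have "(S * v + 2 * c * a * \<beta> * s)\<^sup>2 - a * (d\<^sup>2 - 4 * b * c\<^sup>2) * s\<^sup>2
          = S * ((v * \<gamma> + a * s * \<delta>)\<^sup>2 - a * (v * \<delta> + s * \<gamma>)\<^sup>2)"
    unfolding q[symmetric] ab[symmetric] S_def by algebra
  moreover have "S * v + 2 * c * a * \<beta> * s \<noteq> 0 \<or> s \<noteq> 0"
    using vs S unfolding S_def by auto
  ultimately show ?thesis unfolding S_def by blast
qed

section \<open>Hilbert symbols over k and k(sqrt e)\<close>

text \<open>A hyperbolic plane represents 1: solve x - y = 1/a and x + y = 1. This settles the cases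
  where the second entry of a symbol is -a up to squares.\<close>

lemma difference_of_squares_surj:
  fixes a :: "'k::field"
  assumes two: "(2::'k) \<noteq> 0" and a0: "a \<noteq> 0"
  shows "\<exists>x y. a * x\<^sup>2 - a * y\<^sup>2 = 1"
proof -
  define x where "x = (1 + 1 / a) / 2"
  define y where "y = (1 - 1 / a) / 2"
  have "x - y = 1 / a" "x + y = 1"
    using two a0 unfolding x_def y_def by (simp_all add: divide_simps)
  hence "a * (x - y) * (x + y) = 1" using a0 by simp
  hence "a * x\<^sup>2 - a * y\<^sup>2 = 1" by algebra
  thus ?thesis by blast
qed

lemma hilbert_zero_iff:
  fixes a b :: "'k::field"
  assumes a: "\<not> (\<exists>r. r\<^sup>2 = a)" and two: "(2::'k) \<noteq> 0" and b: "b \<noteq> 0"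
  shows "hilbert_zero a b \<longleftrightarrow> (\<exists>u v. u\<^sup>2 - a * v\<^sup>2 = b)"
proof
  assume "hilbert_zero a b"
  then obtain x y where xy: "a * x\<^sup>2 + b * y\<^sup>2 = 1" unfolding hilbert_zero_def by blast
  have "y \<noteq> 0"
  proof
    assume "y = 0"
    with xy have "a * x\<^sup>2 = 1" by simp
    hence "(1 / x)\<^sup>2 = a" by (cases "x = 0") (auto simp: power_divide divide_simps)
    with a show False by blast
  qed
  hence "(1 / y)\<^sup>2 - a * (x / y)\<^sup>2 = b" using xy by (simp add: power_divide field_simps)
  then show "\<exists>u v. u\<^sup>2 - a * v\<^sup>2 = b" by blast
next
  have a0: "a \<noteq> 0" using a by (metis zero_power2)
  assume "\<exists>u v. u\<^sup>2 - a * v\<^sup>2 = b"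
  then obtain u v where uv: "u\<^sup>2 - a * v\<^sup>2 = b" by blast
  show "hilbert_zero a b"
  \<comment> \<open>Dividing by u^2 gives the symbol equation; if u = 0, then b = -a v^2 and the
    form a x^2 + b y^2 is hyperbolic.\<close>
  proof (cases "u = 0")
    case False
    hence "a * (v / u)\<^sup>2 + b * (1 / u)\<^sup>2 = 1" unfolding uv[symmetric]
      by (simp add: power_divide field_simps)
    then show ?thesis unfolding hilbert_zero_def by blast
  next
    case True
    hence v: "v \<noteq> 0" "b = - a * v\<^sup>2" using uv b by auto
    obtain x y where "a * x\<^sup>2 - a * y\<^sup>2 = 1"
      using difference_of_squares_surj[OF two a0] by blast
    hence "a * x\<^sup>2 + b * (y / v)\<^sup>2 = 1" using v by (simp add: power_divide)
    then show ?thesis unfolding hilbert_zero_def by blast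
  qed
qed

text \<open>Compares coordinates with respect to 1 and sqrt e; the factor 2 of the mixed terms is
  cancelled in the second one.\<close>

lemma hilbert_zero_sqrt_nonsquare_iff:
  fixes e u v :: "'k::field"
  assumes e: "\<not> (\<exists>r. r\<^sup>2 = e)" and two: "(2::'k) \<noteq> 0"
  shows "hilbert_zero_sqrt e u v \<longleftrightarrow>
    (\<exists>x1 x2 y1 y2. u * (x1\<^sup>2 + e * x2\<^sup>2) + v * (y1\<^sup>2 + e * y2\<^sup>2) = 1
        \<and> u * x1 * x2 + v * y1 * y2 = 0)"
proof -
  have "(u * (2 * (x1 * x2)) + v * (2 * (y1 * y2)) = 0) = (u * x1 * x2 + v * y1 * y2 = 0)" for x1 x2 y1 y2
  proof -
    have "u * (2 * (x1 * x2)) + v * (2 * (y1 * y2)) = 2 * (u * x1 * x2 + v * y1 * y2)"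
      by (simp add: algebra_simps)
    thus ?thesis using two by (simp only: mult_eq_0_iff simp_thms)
  qed
  thus ?thesis
    using e unfolding hilbert_zero_sqrt_def sq_add_def sq_mult_def
    by (simp add: split_paired_Ex power2_eq_square algebra_simps mult_2)
qed

text \<open>Over k(sqrt e) the quaternary form becomes the norm form of the quaternion algebra (a,
  S). The substance is the descent: a quaternary form of discriminant e that is isotropic over
  k(sqrt e) is already isotropic over k.\<close>

lemma isotropic_iff_hilbert_zero_sqrt:
  fixes a e S :: "'k::field"
  assumes a: "\<not> (\<exists>r. r\<^sup>2 = a)" and two: "(2::'k) \<noteq> 0" and e0: "e \<noteq> 0" and S: "S \<noteq> 0"
  shows "(\<exists>P s g h. (P \<noteq> 0 \<or> s \<noteq> 0) \<and> P\<^sup>2 - a * e * s\<^sup>2 = S * (g\<^sup>2 - a * h\<^sup>2))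
           \<longleftrightarrow> hilbert_zero_sqrt e a S"
proof (cases "\<exists>r. r\<^sup>2 = e")
  case True
  then obtain r where r: "r\<^sup>2 = e" by blast
  have r0: "r \<noteq> 0" using r e0 by auto
  \<comment> \<open>With e = r^2, replacing s by r s makes the left side a norm from k(sqrt a), so S
    is a quotient of two norms.\<close>
  have "(\<exists>P s g h. (P \<noteq> 0 \<or> s \<noteq> 0) \<and> P\<^sup>2 - a * e * s\<^sup>2 = S * (g\<^sup>2 - a * h\<^sup>2))
           \<longleftrightarrow> (\<exists>u v. u\<^sup>2 - a * v\<^sup>2 = S)"
  proof
    assume "\<exists>P s g h. (P \<noteq> 0 \<or> s \<noteq> 0) \<and> P\<^sup>2 - a * e * s\<^sup>2 = S * (g\<^sup>2 - a * h\<^sup>2)"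
    then obtain P s g h where nz: "P \<noteq> 0 \<or> s \<noteq> 0"
      and "P\<^sup>2 - a * e * s\<^sup>2 = S * (g\<^sup>2 - a * h\<^sup>2)" by blast
    hence eq: "P\<^sup>2 - a * (r * s)\<^sup>2 = S * (g\<^sup>2 - a * h\<^sup>2)"
      using r by (simp add: power_mult_distrib mult.assoc)
    have n: "g\<^sup>2 - a * h\<^sup>2 \<noteq> 0"
      using eq norm_form_eq_0D[OF a, of P "r * s"] nz r0 by auto
    show "\<exists>u v. u\<^sup>2 - a * v\<^sup>2 = S"
      using norm_form_divide[OF n, of P "r * s"] n unfolding eq by auto
  next
    assume "\<exists>u v. u\<^sup>2 - a * v\<^sup>2 = S"
    then obtain u v where "u\<^sup>2 - a * v\<^sup>2 = S" by blast
    then show "\<exists>P s g h. (P \<noteq> 0 \<or> s \<noteq> 0) \<and> P\<^sup>2 - a * e * s\<^sup>2 = S * (g\<^sup>2 - a * h\<^sup>2)"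
      using S by (intro exI[of _ S] exI[of _ 0] exI[of _ u] exI[of _ v]) (auto simp: power2_eq_square)
  qed
  with True show ?thesis
    unfolding hilbert_zero_sqrt_def using hilbert_zero_iff[OF a two S] by simp
next
  case False
  show ?thesis unfolding hilbert_zero_sqrt_nonsquare_iff[OF False two]
  proof
    assume "\<exists>P s g h. (P \<noteq> 0 \<or> s \<noteq> 0) \<and> P\<^sup>2 - a * e * s\<^sup>2 = S * (g\<^sup>2 - a * h\<^sup>2)"
    then obtain P s g h where nz: "P \<noteq> 0 \<or> s \<noteq> 0"
      and eq: "P\<^sup>2 - a * e * s\<^sup>2 = S * (g\<^sup>2 - a * h\<^sup>2)" by blast
    have a0: "a \<noteq> 0" using a by (metis zero_power2)
    obtain x y where xy: "a * x\<^sup>2 - a * y\<^sup>2 = 1"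
      using difference_of_squares_surj[OF two a0] by blast
    \<comment> \<open>The exceptional cases are those with P g = s h = 0: either a is a square in
      k(sqrt e), or S is -a or -a e up to squares in k, so that the form a x^2 + S y^2 is hyperbolic
      over k(sqrt e).\<close>
    consider (degenerate) "g = 0" "h = 0" | (rational) "s = 0" "g = 0" "h \<noteq> 0"
      | (irrational) "P = 0" "h = 0" "g \<noteq> 0"
      | (generic) "(P * g)\<^sup>2 - e * (a * s * h)\<^sup>2 \<noteq> 0"
      using norm_form_eq_0D[OF False, of "P * g" "a * s * h"] a0 nz by auto
    then show "\<exists>x1 x2 y1 y2. a * (x1\<^sup>2 + e * x2\<^sup>2) + S * (y1\<^sup>2 + e * y2\<^sup>2) = 1
        \<and> a * x1 * x2 + S * y1 * y2 = 0"
    proof cases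
      case degenerate
      hence P: "P\<^sup>2 = a * e * s\<^sup>2" using eq by simp
      hence "P \<noteq> 0" using nz a0 e0 by auto
      hence "a * (0\<^sup>2 + e * (s / P)\<^sup>2) + S * (0\<^sup>2 + e * 0\<^sup>2) = 1"
        using P by (auto simp: power_divide field_simps)
      then show ?thesis by (intro exI[of _ 0] exI[of _ "s / P"]) auto
    next
      case rational
      hence P: "P\<^sup>2 = - S * a * h\<^sup>2" "P \<noteq> 0" using eq nz by auto
      have "a * (x\<^sup>2 + e * 0\<^sup>2) + S * ((y * a * h / P)\<^sup>2 + e * 0\<^sup>2) = 1"
        using P xy S a0 rational by (simp add: power_divide power_mult_distrib power2_eq_square[of a] field_simps)
      then show ?thesis by (intro exI[of _ x] exI[of _ 0] exI[of _ "y * a * h / P"]) auto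
    next
      case irrational
      hence P: "S * g\<^sup>2 = - a * e * s\<^sup>2" "s \<noteq> 0" using eq nz by auto
      have "S * (0\<^sup>2 + e * (y * g / (s * e))\<^sup>2) = - a * y\<^sup>2"
        using P e0 by (simp add: power_divide power_mult_distrib field_simps) algebra
      hence "a * (x\<^sup>2 + e * 0\<^sup>2) + S * (0\<^sup>2 + e * (y * g / (s * e))\<^sup>2) = 1"
        using xy by simp
      then show ?thesis by (intro exI[of _ x] exI[of _ 0] exI[of _ "y * g / (s * e)"]) auto
    next
      case generic
      \<comment> \<open>Over k(sqrt e), the quotient (P + s sqrt e sqrt a) / (g + h sqrt a) = u + v
        sqrt a has norm S. The solution is x = v / u, y = 1 / u, and D is the common denominator
        after rationalizing u.\<close>
      define D where "D = (P * g)\<^sup>2 - e * (a * s * h)\<^sup>2"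
      define x1 where "x1 = a * s\<^sup>2 * g * h * e - P\<^sup>2 * g * h"
      define x2 where "x2 = P * s * g\<^sup>2 - P * a * s * h\<^sup>2"
      define y1 where "y1 = (g\<^sup>2 - a * h\<^sup>2) * (P * g)"
      define y2 where "y2 = (g\<^sup>2 - a * h\<^sup>2) * (a * s * h)"
      have 1: "a * (x1\<^sup>2 + e * x2\<^sup>2) + S * (y1\<^sup>2 + e * y2\<^sup>2) = D\<^sup>2"
        using eq unfolding x1_def x2_def y1_def y2_def D_def by algebra
      have 2: "a * x1 * x2 + S * y1 * y2 = 0"
        using eq unfolding x1_def x2_def y1_def y2_def D_def by algebra
      have D: "D \<noteq> 0" using generic by (simp add: D_def)
      have "a * ((x1 / D)\<^sup>2 + e * (x2 / D)\<^sup>2) + S * ((y1 / D)\<^sup>2 + e * (y2 / D)\<^sup>2)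
          = (a * (x1\<^sup>2 + e * x2\<^sup>2) + S * (y1\<^sup>2 + e * y2\<^sup>2)) / D\<^sup>2"
        by (simp add: power_divide add_divide_distrib distrib_left)
      moreover have "a * (x1 / D) * (x2 / D) + S * (y1 / D) * (y2 / D)
          = (a * x1 * x2 + S * y1 * y2) / D\<^sup>2"
        by (simp add: add_divide_distrib power2_eq_square)
      ultimately show ?thesis unfolding 1 2 using D
        by (intro exI[of _ "x1 / D"] exI[of _ "x2 / D"] exI[of _ "y1 / D"] exI[of _ "y2 / D"]) simp
    qed
  next
    assume "\<exists>x1 x2 y1 y2. a * (x1\<^sup>2 + e * x2\<^sup>2) + S * (y1\<^sup>2 + e * y2\<^sup>2) = 1
        \<and> a * x1 * x2 + S * y1 * y2 = 0"
    then obtain x1 x2 y1 y2 where 1: "a * (x1\<^sup>2 + e * x2\<^sup>2) + S * (y1\<^sup>2 + e * y2\<^sup>2) = 1"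
      and 2: "a * x1 * x2 + S * y1 * y2 = 0" by blast
    show "\<exists>P s g h. (P \<noteq> 0 \<or> s \<noteq> 0) \<and> P\<^sup>2 - a * e * s\<^sup>2 = S * (g\<^sup>2 - a * h\<^sup>2)"
    proof (cases "y1 = 0 \<and> y2 = 0")
      case True
      hence ax: "a * (x1\<^sup>2 + e * x2\<^sup>2) = 1" "a * x1 * x2 = 0" using 1 2 by auto
      have "x2 \<noteq> 0"
      proof
        assume "x2 = 0"
        hence "(1 / x1)\<^sup>2 = a" using ax by (cases "x1 = 0") (auto simp: power_divide divide_simps)
        with a show False by blast
      qed
      hence "x1 = 0" using ax by auto
      hence "a * e * x2\<^sup>2 = 1" using ax by (simp add: mult.assoc)
      then show ?thesis
        by (intro exI[of _ 1] exI[of _ x2] exI[of _ 0]) simp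
    next
      case False
      have n: "y1\<^sup>2 - e * y2\<^sup>2 \<noteq> 0"
        using norm_form_eq_0D[OF \<open>\<not> (\<exists>r. r\<^sup>2 = e)\<close>] False by blast
      define n where "n = y1\<^sup>2 - e * y2\<^sup>2"
      define v1 where "v1 = x1 * y1 - e * x2 * y2"
      define v2 where "v2 = x2 * y1 - x1 * y2"
      \<comment> \<open>\<open>S\<close> is the norm from \<open>k(\<surd>e, \<surd>a)\<close> of \<open>(u + v \<surd>a) / n\<close> with \<open>u = y1 - y2 \<surd>e\<close> and \<open>v = v1 + v2 \<surd>e\<close>.\<close>
      have Sn: "S * n\<^sup>2 = y1\<^sup>2 + e * y2\<^sup>2 - a * (v1\<^sup>2 + e * v2\<^sup>2)"
        using 1 2 unfolding n_def v1_def v2_def by algebra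
      have tr: "a * v1 * v2 + y1 * y2 = 0"
        using 1 2 n unfolding n_def v1_def v2_def by algebra
      show ?thesis
      proof (cases "y2 = 0 \<and> v2 = 0")
        case True
        hence "(S * n)\<^sup>2 - a * e * 0\<^sup>2 = S * (y1\<^sup>2 - a * v1\<^sup>2)" using Sn
          by (simp add: power_mult_distrib) algebra
        then show ?thesis using S n unfolding n_def by (metis mult_eq_0_iff)
      next
        case False
        \<comment> \<open>Put W0 = y1 + v1 sqrt a and W1 = -y2 + v2 sqrt a, so that S n^2 = N(W0) +
          e N(W1). By \<open>tr\<close> the product of W0 with the conjugate of W1 has trace zero,
          and sqrt a times it is P in k. Thus P^2 = -a N(W0) N(W1), s = N(W1), and the difference
          P^2 - a e s^2 is S n^2 times the norm of sqrt a W1.\<close>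
        define P where "P = a * (v1 * (- y2) - y1 * v2)"
        define s where "s = y2\<^sup>2 - a * v2\<^sup>2"
        have "s \<noteq> 0" using norm_form_eq_0D[OF a] False unfolding s_def by blast
        moreover have "P\<^sup>2 - a * e * s\<^sup>2 = S * ((n * (a * v2))\<^sup>2 - a * (n * y2)\<^sup>2)"
        proof -
          have "P\<^sup>2 - a * e * s\<^sup>2 = (S * n\<^sup>2) * ((a * v2)\<^sup>2 - a * y2\<^sup>2)"
            unfolding Sn P_def s_def using tr by algebra
          thus ?thesis by (simp add: power_mult_distrib algebra_simps)
        qed
        ultimately show ?thesis by blast
      qed
    qed
  qed
qed

text \<open>The left side does not mention the chosen (\<alpha>, \<beta>), so the condition on the
  right is the same for every point of the conic; this makes the existential (v) and the universal
  (vi) agree.\<close>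

lemma rational_point_iff_hilbert_zero_sqrt:
  fixes a b c d \<alpha> \<beta> :: "'k::field"
  assumes a: "\<not> (\<exists>r. r\<^sup>2 = a)" and two: "(2::'k) \<noteq> 0" and b: "\<not> (\<exists>r. r\<^sup>2 = b)"
    and cd: "c \<noteq> 0 \<or> d \<noteq> 0" and ab: "\<alpha>\<^sup>2 - a * \<beta>\<^sup>2 = b"
  shows "(\<exists>\<alpha> \<beta> \<gamma> \<delta>. \<alpha>\<^sup>2 - a * \<beta>\<^sup>2 = b \<and> \<gamma>\<^sup>2 - a * \<delta>\<^sup>2 = 2 * c * \<alpha> + d) \<longleftrightarrow>
    - 2 * c * \<alpha> + d = 0 \<or>
      (- 2 * c * \<alpha> + d \<noteq> 0 \<and> hilbert_zero_sqrt (d\<^sup>2 - 4 * b * c\<^sup>2) a (- 2 * c * \<alpha> + d))"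
proof -
  have b0: "b \<noteq> 0" using b by (metis zero_power2)
  \<comment> \<open>If e = 0, then c is non-zero and b is the square of d / (2 c).\<close>
  have e0: "d\<^sup>2 - 4 * b * c\<^sup>2 \<noteq> 0"
  proof
    assume e: "d\<^sup>2 - 4 * b * c\<^sup>2 = 0"
    have "c \<noteq> 0" using e cd by auto
    have "(4::'k) = 2 * 2" by simp
    hence "(4::'k) \<noteq> 0" using two by (metis mult_eq_0_iff)
    with \<open>c \<noteq> 0\<close> two e have "(d / (2 * c))\<^sup>2 = b"
      by (simp add: power_divide power_mult_distrib nonzero_divide_eq_eq algebra_simps)
    with b show False by blast
  qed
  have S: "- 2 * c * \<alpha> + d = d - 2 * c * \<alpha>" by simp
  show ?thesis
  proof (cases "d - 2 * c * \<alpha> = 0")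
    case True
    \<comment> \<open>The reflected point (-\<alpha>, \<beta>) makes the second equation
      homogeneous, solved by zero.\<close>
    hence "(- \<alpha>)\<^sup>2 - a * \<beta>\<^sup>2 = b \<and> 0\<^sup>2 - a * 0\<^sup>2 = 2 * c * (- \<alpha>) + d" using ab by simp
    with True show ?thesis unfolding S by blast
  next
    case False
    have "(\<exists>\<alpha> \<beta> \<gamma> \<delta>. \<alpha>\<^sup>2 - a * \<beta>\<^sup>2 = b \<and> \<gamma>\<^sup>2 - a * \<delta>\<^sup>2 = 2 * c * \<alpha> + d) \<longleftrightarrow>
      (\<exists>P s g h. (P \<noteq> 0 \<or> s \<noteq> 0) \<and>
         P\<^sup>2 - a * (d\<^sup>2 - 4 * b * c\<^sup>2) * s\<^sup>2 = (d - 2 * c * \<alpha>) * (g\<^sup>2 - a * h\<^sup>2))"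
      using rational_point_of_isotropic[OF a ab False] isotropic_of_rational_point[OF a b0 ab False]
      by blast
    with False show ?thesis
      unfolding S isotropic_iff_hilbert_zero_sqrt[OF a two e0 False] by simp
  qed
qed

subsection \<open>Field homomorphisms and generated subfields\<close>

lemma field_hom_one: "field_hom f \<Longrightarrow> f 1 = 1"
  and field_hom_add: "field_hom f \<Longrightarrow> f (x + y) = f x + f y"
  and field_hom_mult: "field_hom f \<Longrightarrow> f (x * y) = f x * f y"
  by (simp_all add: field_hom_def)

lemma field_hom_zero:
  assumes "field_hom f" shows "f 0 = 0"
  using field_hom_add[OF assms, of 0 0] by (metis add.right_neutral add_left_cancel)

lemma field_hom_uminus:
  assumes "field_hom f" shows "f (- x) = - f x"
  using field_hom_add[OF assms, of x "- x"] field_hom_zero[OF assms]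
  by (simp add: eq_neg_iff_add_eq_0 add.commute)

lemma field_hom_diff: "field_hom f \<Longrightarrow> f (x - y) = f x - f y"
  using field_hom_add[of f x "- y"] field_hom_uminus[of f y] by simp

lemma field_hom_inverse:
  assumes "field_hom f" shows "f (inverse x) = inverse (f x)"
proof (cases "x = 0")
  case False
  have "f x * f (inverse x) = 1"
    using False field_hom_mult[OF assms, of x "inverse x"] field_hom_one[OF assms] by simp
  thus ?thesis by (metis inverse_unique)
qed (simp add: field_hom_zero[OF assms])

lemma field_hom_divide: "field_hom f \<Longrightarrow> f (x / y) = f x / f y"
  by (simp add: divide_inverse field_hom_mult field_hom_inverse)

lemma field_hom_eq_0_iff:
  assumes "field_hom f" shows "f x = 0 \<longleftrightarrow> x = 0"
proof
  assume "f x = 0"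
  show "x = 0"
  proof (rule ccontr)
    assume "x \<noteq> 0"
    hence "f 1 = f x * f (inverse x)" using field_hom_mult[OF assms, of x "inverse x"] by simp
    with \<open>f x = 0\<close> show False by (simp add: field_hom_one[OF assms])
  qed
qed (simp add: field_hom_zero[OF assms])

lemma field_hom_inj: "field_hom f \<Longrightarrow> inj f"
  by (rule injI) (metis field_hom_diff field_hom_eq_0_iff right_minus_eq)

lemma field_hom_power: "field_hom f \<Longrightarrow> f (x ^ n) = f x ^ n"
  by (induction n) (simp_all add: field_hom_one field_hom_mult)

lemma field_hom_sum: "field_hom f \<Longrightarrow> f (sum g A) = (\<Sum>x\<in>A. f (g x))"
  by (induction A rule: infinite_finite_induct) (simp_all add: field_hom_zero field_hom_add)

lemma field_hom_prod: "field_hom f \<Longrightarrow> f (prod g A) = (\<Prod>x\<in>A. f (g x))"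
  by (induction A rule: infinite_finite_induct) (simp_all add: field_hom_one field_hom_mult)

lemma field_hom_numeral: "field_hom f \<Longrightarrow> f (numeral n) = numeral n"
  by (induction n) (simp_all only: field_hom_one field_hom_add numeral.simps)

lemma field_hom_id: "field_hom (\<lambda>x. x)"
  by (simp add: field_hom_def)

lemma field_hom_comp: "field_hom f \<Longrightarrow> field_hom g \<Longrightarrow> field_hom (\<lambda>x. f (g x))"
  by (simp add: field_hom_def)

section \<open>Closure properties of subfields and of generated fields\<close>

lemma subfield_zero: "is_subfield S \<Longrightarrow> 0 \<in> S"
  and subfield_one: "is_subfield S \<Longrightarrow> 1 \<in> S"
  and subfield_add: "is_subfield S \<Longrightarrow> x \<in> S \<Longrightarrow> y \<in> S \<Longrightarrow> x + y \<in> S"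
  and subfield_mult: "is_subfield S \<Longrightarrow> x \<in> S \<Longrightarrow> y \<in> S \<Longrightarrow> x * y \<in> S"
  and subfield_uminus: "is_subfield S \<Longrightarrow> x \<in> S \<Longrightarrow> - x \<in> S"
  and subfield_inverse: "is_subfield S \<Longrightarrow> x \<in> S \<Longrightarrow> inverse x \<in> S"
  by (simp_all add: is_subfield_def)

lemma subfield_diff: "is_subfield S \<Longrightarrow> x \<in> S \<Longrightarrow> y \<in> S \<Longrightarrow> x - y \<in> S"
  by (metis diff_conv_add_uminus subfield_add subfield_uminus)

lemma subfield_divide: "is_subfield S \<Longrightarrow> x \<in> S \<Longrightarrow> y \<in> S \<Longrightarrow> x / y \<in> S"
  by (simp add: divide_inverse subfield_mult subfield_inverse)

lemma subfield_power: "is_subfield S \<Longrightarrow> x \<in> S \<Longrightarrow> x ^ n \<in> S"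
  by (induction n) (simp_all add: subfield_one subfield_mult)

lemma subfield_sum: "is_subfield S \<Longrightarrow> (\<And>x. x \<in> A \<Longrightarrow> f x \<in> S) \<Longrightarrow> sum f A \<in> S"
  by (induction A rule: infinite_finite_induct) (simp_all add: subfield_zero subfield_add)

lemma subfield_prod: "is_subfield S \<Longrightarrow> (\<And>x. x \<in> A \<Longrightarrow> f x \<in> S) \<Longrightarrow> prod f A \<in> S"
  by (induction A rule: infinite_finite_induct) (simp_all add: subfield_one subfield_mult)

lemmas subfield_closed = subfield_zero subfield_one subfield_add subfield_mult subfield_uminus
  subfield_inverse subfield_diff subfield_divide subfield_power

lemma is_subfield_gen_field: "is_subfield (gen_field A)"
  unfolding is_subfield_def gen_field_def by blast

lemma gen_field_superset: "A \<subseteq> gen_field A"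
  unfolding gen_field_def by blast

lemma gen_field_least: "A \<subseteq> S \<Longrightarrow> is_subfield S \<Longrightarrow> gen_field A \<subseteq> S"
  unfolding gen_field_def by blast

lemma is_subfield_image:
  assumes "field_hom h" "is_subfield S" shows "is_subfield (h ` S)"
  unfolding is_subfield_def
proof (intro conjI ballI)
  show "0 \<in> h ` S" "1 \<in> h ` S"
    using subfield_zero[OF assms(2)] subfield_one[OF assms(2)]
      field_hom_zero[OF assms(1)] field_hom_one[OF assms(1)] by (metis imageI)+
next
  fix u v assume "u \<in> h ` S" "v \<in> h ` S"
  then show "u + v \<in> h ` S" "u * v \<in> h ` S"
    using subfield_add[OF assms(2)] subfield_mult[OF assms(2)]
    by (auto simp: field_hom_add[OF assms(1), symmetric] field_hom_mult[OF assms(1), symmetric])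
next
  fix u assume "u \<in> h ` S"
  then show "- u \<in> h ` S" "inverse u \<in> h ` S"
    using subfield_uminus[OF assms(2)] subfield_inverse[OF assms(2)]
    by (auto simp: field_hom_uminus[OF assms(1), symmetric] field_hom_inverse[OF assms(1), symmetric])
qed

lemma is_subfield_UNIV: "is_subfield UNIV"
  by (simp add: is_subfield_def)

lemma is_subfield_range: "field_hom h \<Longrightarrow> is_subfield (range h)"
  by (rule is_subfield_image[OF _ is_subfield_UNIV])

lemma is_subfield_vimage:
  "field_hom h \<Longrightarrow> is_subfield S \<Longrightarrow> is_subfield (h -` S)"
  by (simp add: is_subfield_def field_hom_zero field_hom_one field_hom_add field_hom_mult
        field_hom_uminus field_hom_inverse)

lemma gen_field_image:
  assumes "field_hom h" shows "gen_field (h ` A) = h ` gen_field A"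
proof
  show "gen_field (h ` A) \<subseteq> h ` gen_field A"
    by (intro gen_field_least image_mono gen_field_superset is_subfield_image assms
          is_subfield_gen_field)
  have "gen_field A \<subseteq> h -` gen_field (h ` A)"
    using gen_field_superset[of "h ` A"]
    by (intro gen_field_least is_subfield_vimage assms is_subfield_gen_field) blast
  thus "h ` gen_field A \<subseteq> gen_field (h ` A)" by blast
qed

subsection \<open>Evaluation of multivariate polynomials\<close>

definition monom_eval :: "(nat \<Rightarrow> 'b::field) \<Rightarrow> (nat \<Rightarrow>\<^sub>0 nat) \<Rightarrow> 'b" where
  "monom_eval x m = (\<Prod>l\<in>Poly_Mapping.keys m. x l ^ Poly_Mapping.lookup m l)"

text \<open>Coefficients stay in the abstract field and are moved along \<open>j\<close> only on
  evaluation, so one polynomial over k can be evaluated in k, in L or in a rational function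
  field.\<close>

definition hom_eval :: "('a::field \<Rightarrow> 'b::field) \<Rightarrow> (nat \<Rightarrow> 'b) \<Rightarrow> ((nat \<Rightarrow>\<^sub>0 nat) \<Rightarrow>\<^sub>0 'a) \<Rightarrow> 'b" where
  "hom_eval j x p = (\<Sum>m\<in>Poly_Mapping.keys p. j (Poly_Mapping.lookup p m) * monom_eval x m)"

lemma mpoly_eval_eq_hom_eval: "mpoly_eval p x = hom_eval (\<lambda>z. z) x p"
  by (simp add: mpoly_eval_def hom_eval_def monom_eval_def)

lemma monom_eval_superset:
  assumes "finite A" "Poly_Mapping.keys m \<subseteq> A"
  shows "monom_eval x m = (\<Prod>l\<in>A. x l ^ Poly_Mapping.lookup m l)"
  unfolding monom_eval_def using assms
  by (intro prod.mono_neutral_left) (auto simp: in_keys_iff)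

lemma monom_eval_add: "monom_eval x (m + m') = monom_eval x m * monom_eval x m'"
proof -
  let ?A = "Poly_Mapping.keys m \<union> Poly_Mapping.keys m'"
  have "monom_eval x (m + m') = (\<Prod>l\<in>?A. x l ^ Poly_Mapping.lookup (m + m') l)"
    by (rule monom_eval_superset) (simp, rule Poly_Mapping.keys_add)
  also have "\<dots> = (\<Prod>l\<in>?A. x l ^ Poly_Mapping.lookup m l) * (\<Prod>l\<in>?A. x l ^ Poly_Mapping.lookup m' l)"
    by (simp add: lookup_add power_add prod.distrib)
  also have "\<dots> = monom_eval x m * monom_eval x m'"
    by (subst (1 2) monom_eval_superset[of ?A]) simp_all
  finally show ?thesis .
qed

lemma monom_eval_zero: "monom_eval x 0 = 1"
  by (simp add: monom_eval_def)

lemma monom_eval_single: "monom_eval x (Poly_Mapping.single l n) = x l ^ n"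
  by (simp add: monom_eval_def)

lemma hom_eval_superset:
  assumes "field_hom j" "finite A" "Poly_Mapping.keys p \<subseteq> A"
  shows "hom_eval j x p = (\<Sum>m\<in>A. j (Poly_Mapping.lookup p m) * monom_eval x m)"
  unfolding hom_eval_def using assms
  by (intro sum.mono_neutral_left) (auto simp: in_keys_iff field_hom_zero)

lemma hom_eval_add:
  assumes "field_hom j" shows "hom_eval j x (p + q) = hom_eval j x p + hom_eval j x q"
proof -
  let ?A = "Poly_Mapping.keys p \<union> Poly_Mapping.keys q"
  have "hom_eval j x (p + q) = (\<Sum>m\<in>?A. j (Poly_Mapping.lookup (p + q) m) * monom_eval x m)"
    by (rule hom_eval_superset[OF assms]) (simp, rule Poly_Mapping.keys_add)
  also have "\<dots> = (\<Sum>m\<in>?A. j (Poly_Mapping.lookup p m) * monom_eval x m)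
      + (\<Sum>m\<in>?A. j (Poly_Mapping.lookup q m) * monom_eval x m)"
    by (simp add: lookup_add field_hom_add[OF assms] distrib_right sum.distrib)
  also have "\<dots> = hom_eval j x p + hom_eval j x q"
    by (subst (1 2) hom_eval_superset[OF assms, of ?A]) simp_all
  finally show ?thesis .
qed

lemma hom_eval_zero: "hom_eval j x 0 = 0"
  by (simp add: hom_eval_def)

lemma hom_eval_single:
  "field_hom j \<Longrightarrow> hom_eval j x (Poly_Mapping.single m z) = j z * monom_eval x m"
  by (simp add: hom_eval_def field_hom_zero)

lemma hom_eval_sum:
  "field_hom j \<Longrightarrow> hom_eval j x (sum f A) = (\<Sum>u\<in>A. hom_eval j x (f u))"
  by (induction A rule: infinite_finite_induct) (simp_all add: hom_eval_zero hom_eval_add)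

lemma poly_mapping_eq_sum_single:
  "p = (\<Sum>m\<in>Poly_Mapping.keys p. Poly_Mapping.single m (Poly_Mapping.lookup p m))"
  by (rule poly_mapping_eqI)
     (simp add: lookup_sum lookup_single when_def sum.delta in_keys_iff)

lemma hom_eval_mult:
  assumes "field_hom j" shows "hom_eval j x (p * q) = hom_eval j x p * hom_eval j x q"
proof -
  have "p * q = (\<Sum>m\<in>Poly_Mapping.keys p. \<Sum>m'\<in>Poly_Mapping.keys q.
      Poly_Mapping.single (m + m') (Poly_Mapping.lookup p m * Poly_Mapping.lookup q m'))"
    by (subst poly_mapping_eq_sum_single[of p], subst poly_mapping_eq_sum_single[of q])
       (simp add: sum_product mult_single)
  thus ?thesis
    by (simp add: hom_eval_sum[OF assms] hom_eval_single[OF assms] field_hom_mult[OF assms]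
          monom_eval_add hom_eval_def[of j x p] hom_eval_def[of j x q] sum_product mult_ac)
qed

lemma hom_eval_uminus:
  assumes "field_hom j" shows "hom_eval j x (- p) = - hom_eval j x p"
  using hom_eval_add[OF assms, of x p "- p"] hom_eval_zero[of j x]
  by (simp add: eq_neg_iff_add_eq_0 add.commute)

lemma hom_eval_diff:
  assumes "field_hom j" shows "hom_eval j x (p - q) = hom_eval j x p - hom_eval j x q"
  using hom_eval_add[OF assms, of x p "- q"] hom_eval_uminus[OF assms, of x q] by simp

lemma hom_eval_const: "field_hom j \<Longrightarrow> hom_eval j x (Poly_Mapping.single 0 z) = j z"
  by (simp add: hom_eval_single monom_eval_zero)

lemma hom_eval_one: "field_hom j \<Longrightarrow> hom_eval j x 1 = 1"
  using hom_eval_const[of j x 1] by (simp add: field_hom_one)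

lemma hom_eval_var:
  "field_hom j \<Longrightarrow> hom_eval j x (Poly_Mapping.single (Poly_Mapping.single l 1) 1) = x l"
  by (simp add: hom_eval_single monom_eval_single field_hom_one)

lemma hom_eval_hom:
  "field_hom h \<Longrightarrow> hom_eval (\<lambda>z. h (j z)) (\<lambda>l. h (x l)) p = h (hom_eval j x p)"
  by (simp add: hom_eval_def monom_eval_def field_hom_sum field_hom_mult field_hom_prod field_hom_power)

section \<open>Polynomials in the first n variables and algebraic independence\<close>

definition vars_below :: "nat \<Rightarrow> ((nat \<Rightarrow>\<^sub>0 nat) \<Rightarrow>\<^sub>0 'a::zero) \<Rightarrow> bool" where
  "vars_below n p \<longleftrightarrow> (\<forall>m\<in>Poly_Mapping.keys p. Poly_Mapping.keys m \<subseteq> {..<n})"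

text \<open>Polynomials over the subfield \<open>range j\<close> and polynomials over k correspond
  under \<open>j\<close> and \<open>inv j\<close>, coefficient by coefficient, because
  \<open>j\<close> is injective.\<close>

lemma alg_indep_range_iff:
  assumes j: "field_hom j"
  shows "alg_indep (range j) x n \<longleftrightarrow> (\<forall>p. vars_below n p \<and> hom_eval j x p = 0 \<longrightarrow> p = 0)"
proof
  assume L: "alg_indep (range j) x n"
  show "\<forall>p. vars_below n p \<and> hom_eval j x p = 0 \<longrightarrow> p = 0"
  proof (intro allI impI)
    fix p assume p: "vars_below n p \<and> hom_eval j x p = 0"
    define q where "q = Poly_Mapping.map j p"
    have lq: "Poly_Mapping.lookup q m = j (Poly_Mapping.lookup p m)" for m
      by (simp add: q_def Poly_Mapping.map.rep_eq when_def field_hom_zero[OF j])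
    have kq: "Poly_Mapping.keys q = Poly_Mapping.keys p"
      by (auto simp: in_keys_iff lq field_hom_eq_0_iff[OF j])
    have "mpoly_eval q x = hom_eval j x p"
      by (simp add: mpoly_eval_eq_hom_eval hom_eval_def kq lq)
    with L p have "q = 0" unfolding alg_indep_def by (auto simp: kq lq vars_below_def)
    with kq[symmetric] show "p = 0" by simp
  qed
next
  assume R: "\<forall>p. vars_below n p \<and> hom_eval j x p = 0 \<longrightarrow> p = 0"
  show "alg_indep (range j) x n"
    unfolding alg_indep_def
  proof (intro allI impI)
    fix q
    assume q: "(\<forall>m\<in>Poly_Mapping.keys q. Poly_Mapping.lookup q m \<in> range j
                 \<and> Poly_Mapping.keys m \<subseteq> {..<n}) \<and> mpoly_eval q x = 0"
    define p where "p = Poly_Mapping.map (inv j) q"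
    have i0: "inv j 0 = 0"
      by (metis field_hom_inj field_hom_zero inv_f_f j)
    have lp: "Poly_Mapping.lookup p m = inv j (Poly_Mapping.lookup q m)" for m
      by (simp add: p_def Poly_Mapping.map.rep_eq when_def i0)
    have jl: "j (Poly_Mapping.lookup p m) = Poly_Mapping.lookup q m" for m
    proof (cases "m \<in> Poly_Mapping.keys q")
      case True
      thus ?thesis using q by (simp add: lp f_inv_into_f)
    next
      case False
      thus ?thesis by (simp add: lp i0 in_keys_iff field_hom_zero[OF j])
    qed
    have kp: "Poly_Mapping.keys p = Poly_Mapping.keys q"
      using field_hom_eq_0_iff[OF j] jl by (metis in_keys_iff subsetI subset_antisym)
    have "hom_eval j x p = mpoly_eval q x"
      by (simp add: mpoly_eval_eq_hom_eval hom_eval_def kp jl)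
    with R q have "p = 0" by (auto simp: vars_below_def kp)
    with kp[symmetric] show "q = 0" by simp
  qed
qed

lemma vars_below_single:
  "Poly_Mapping.keys m \<subseteq> {..<n} \<Longrightarrow> vars_below n (Poly_Mapping.single m z)"
  by (simp add: vars_below_def)

lemma vars_below_const: "vars_below n (Poly_Mapping.single 0 z)"
  by (simp add: vars_below_def)

lemma vars_below_one: "vars_below n 1"
  by (simp add: vars_below_def)

lemma vars_below_add: "vars_below n p \<Longrightarrow> vars_below n q \<Longrightarrow> vars_below n (p + q)"
  unfolding vars_below_def using Poly_Mapping.keys_add[of p q] by blast

lemma vars_below_uminus: "vars_below n p \<Longrightarrow> vars_below n (- p :: _ \<Rightarrow>\<^sub>0 'a::ab_group_add)"
  unfolding vars_below_def by (simp add: in_keys_iff)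

lemma vars_below_mult:
  assumes "vars_below n p" "vars_below n q" shows "vars_below n (p * q)"
  unfolding vars_below_def
proof
  fix m assume "m \<in> Poly_Mapping.keys (p * q)"
  then obtain u v where "m = u + v" "u \<in> Poly_Mapping.keys p" "v \<in> Poly_Mapping.keys q"
    using keys_mult[of p q] by blast
  thus "Poly_Mapping.keys m \<subseteq> {..<n}"
    using assms Poly_Mapping.keys_add[of u v] unfolding vars_below_def by blast
qed

subsection \<open>Specialization\<close>

text \<open>The lowest digit is the residue modulo D; cancel it, divide by D and induct.\<close>

lemma digit_expansion_unique:
  fixes f g :: "nat \<Rightarrow> nat"
  assumes "\<And>l. l < n \<Longrightarrow> f l < D" "\<And>l. l < n \<Longrightarrow> g l < D"
    and "(\<Sum>l<n. f l * D ^ l) = (\<Sum>l<n. g l * D ^ l)" and "l < n"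
  shows "f l = g l"
  using assms
proof (induction n arbitrary: f g l)
  case (Suc n)
  have split: "(\<Sum>l<Suc n. h l * D ^ l) = h 0 + D * (\<Sum>l<n. h (Suc l) * D ^ l)" for h :: "nat \<Rightarrow> nat"
    by (simp add: sum.lessThan_Suc_shift sum_distrib_left mult_ac del: sum.lessThan_Suc)
  have eq: "f 0 + D * (\<Sum>l<n. f (Suc l) * D ^ l) = g 0 + D * (\<Sum>l<n. g (Suc l) * D ^ l)"
    using Suc.prems(3) unfolding split .
  have lt: "f 0 < D" "g 0 < D" using Suc.prems by auto
  have "f 0 = (f 0 + D * (\<Sum>l<n. f (Suc l) * D ^ l)) mod D" using lt by simp
  also have "\<dots> = g 0" unfolding eq using lt by simp
  finally have 0: "f 0 = g 0" .
  with eq lt have rest: "(\<Sum>l<n. f (Suc l) * D ^ l) = (\<Sum>l<n. g (Suc l) * D ^ l)" by simp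
  show ?case
  proof (cases l)
    case 0
    thus ?thesis using \<open>f 0 = g 0\<close> by simp
  next
    case (Suc l')
    thus ?thesis using Suc.IH[of "\<lambda>l. f (Suc l)" "\<lambda>l. g (Suc l)" l'] rest Suc.prems by auto
  qed
qed simp

text \<open>Kronecker substitution: for \<open>D\<close> larger than all exponents, \<open>x\<^sub>l = t ^ (D ^ l)\<close> maps distinct
  monomials to distinct powers of \<open>t\<close>.\<close>
lemma ex_nonzero_hom_eval:
  fixes p :: "(nat \<Rightarrow>\<^sub>0 nat) \<Rightarrow>\<^sub>0 'k::field"
  assumes inf: "infinite (UNIV :: 'k set)" and p0: "p \<noteq> 0"
  shows "\<exists>v. hom_eval (\<lambda>z. z) v p \<noteq> 0"
proof -
  define V where "V = (\<Union>m\<in>Poly_Mapping.keys p. Poly_Mapping.keys m)"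
  define W where "W = (\<Union>m\<in>Poly_Mapping.keys p. Poly_Mapping.lookup m ` V)"
  have "finite V" "finite W" unfolding V_def W_def by auto
  then obtain n D where n: "\<And>l. l \<in> V \<Longrightarrow> l < n" and D: "\<And>u. u \<in> W \<Longrightarrow> u < D"
    by (metis finite_nat_set_iff_bounded)
  \<comment> \<open>The exponent of t that the monomial m acquires under the substitution; its
    digits in base D are the exponents in m.\<close>
  define ex where "ex m = (\<Sum>l\<in>V. Poly_Mapping.lookup m l * D ^ l)" for m :: "nat \<Rightarrow>\<^sub>0 nat"
  have inj: "inj_on ex (Poly_Mapping.keys p)"
  proof (rule inj_onI, rule poly_mapping_eqI)
    fix m m' l assume m: "m \<in> Poly_Mapping.keys p" "m' \<in> Poly_Mapping.keys p" and "ex m = ex m'"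
    have ex: "ex u = (\<Sum>l<n. (if l \<in> V then Poly_Mapping.lookup u l else 0) * D ^ l)" for u
      unfolding ex_def using n by (intro sum.mono_neutral_cong_left) auto
    have out: "Poly_Mapping.lookup u l = 0" if "u \<in> Poly_Mapping.keys p" "l \<notin> V" for u
      using that unfolding V_def by (auto simp: in_keys_iff)
    show "Poly_Mapping.lookup m l = Poly_Mapping.lookup m' l"
    proof (cases "l \<in> V")
      case True
      hence lt: "Poly_Mapping.lookup u r < D" if "u \<in> Poly_Mapping.keys p" "r \<in> V" for u r
        using D that unfolding W_def by blast
      have D0: "0 < D" using lt[OF m(1) True] by simp
      have "(if l \<in> V then Poly_Mapping.lookup m l else 0) = (if l \<in> V then Poly_Mapping.lookup m' l else 0)"
        using \<open>ex m = ex m'\<close> m lt D0 n[OF True] unfolding ex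
        by (intro digit_expansion_unique[of n "\<lambda>l. if l \<in> V then Poly_Mapping.lookup m l else 0" D
              "\<lambda>l. if l \<in> V then Poly_Mapping.lookup m' l else 0" l]) auto
      thus ?thesis using True by simp
    qed (simp add: out m)
  qed
  define P where "P = (\<Sum>m\<in>Poly_Mapping.keys p. monom (Poly_Mapping.lookup p m) (ex m))"
  have "P \<noteq> 0"
  proof -
    obtain m where m: "m \<in> Poly_Mapping.keys p" using p0 by fastforce
    have "coeff P (ex m) = (\<Sum>m'\<in>Poly_Mapping.keys p. if m' = m then Poly_Mapping.lookup p m else 0)"
      unfolding P_def coeff_sum coeff_monom
      using inj m by (intro sum.cong) (auto simp: inj_on_def)
    also have "\<dots> \<noteq> 0" using m by (simp add: in_keys_iff)
    finally show ?thesis by auto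
  qed
  hence "finite {t. poly P t = 0}" by (rule poly_roots_finite)
  then obtain t where t: "poly P t \<noteq> 0" using inf by (metis (mono_tags) UNIV_eq_I mem_Collect_eq)
  have "monom_eval (\<lambda>l. t ^ (D ^ l)) m = t ^ ex m" if "m \<in> Poly_Mapping.keys p" for m
  proof -
    have "monom_eval (\<lambda>l. t ^ (D ^ l)) m = (\<Prod>l\<in>V. (t ^ (D ^ l)) ^ Poly_Mapping.lookup m l)"
      using that \<open>finite V\<close> by (intro monom_eval_superset) (auto simp: V_def)
    thus ?thesis by (simp add: ex_def power_sum power_mult[symmetric] mult.commute)
  qed
  hence "hom_eval (\<lambda>z. z) (\<lambda>l. t ^ (D ^ l)) p = poly P t"
    by (simp add: hom_eval_def P_def poly_sum poly_monom)
  with t show ?thesis by metis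
qed

section \<open>Rational functions as quotients of polynomials, and their specialization\<close>

definition rf_poly :: "((nat \<Rightarrow>\<^sub>0 nat) \<Rightarrow>\<^sub>0 'k::field) \<Rightarrow> 'k ratfun" where
  "rf_poly p = Fraction_Field.Fract p 1"

lemma rf_poly_add: "rf_poly (p + q) = rf_poly p + rf_poly q"
  and rf_poly_diff: "rf_poly (p - q) = rf_poly p - rf_poly q"
  and rf_poly_mult: "rf_poly (p * q) = rf_poly p * rf_poly q"
  by (simp_all add: rf_poly_def)

lemma rf_poly_zero: "rf_poly 0 = 0" and rf_poly_one: "rf_poly 1 = 1"
  by (simp_all add: rf_poly_def Zero_fract_def One_fract_def)

lemma rf_poly_eq_iff: "rf_poly p = rf_poly q \<longleftrightarrow> p = q"
  by (simp add: rf_poly_def eq_fract)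

lemma rf_poly_eq_0_iff: "rf_poly p = 0 \<longleftrightarrow> p = 0"
  using rf_poly_eq_iff[of p 0] by (simp add: rf_poly_zero)

lemma Fract_eq_rf_poly_divide: "Fraction_Field.Fract p q = rf_poly p / rf_poly q"
  by (simp add: rf_poly_def)

lemma rf_const_eq_rf_poly: "rf_const z = rf_poly (Poly_Mapping.single 0 z)"
  by (simp add: rf_const_def rf_poly_def)

lemma rf_var_eq_rf_poly: "rf_var l = rf_poly (Poly_Mapping.single (Poly_Mapping.single l 1) 1)"
  by (simp add: rf_var_def rf_poly_def)

lemma rf_poly_sum: "rf_poly (sum f A) = (\<Sum>u\<in>A. rf_poly (f u))"
  by (induction A rule: infinite_finite_induct) (simp_all add: rf_poly_zero rf_poly_add)

lemma rf_poly_power: "rf_poly (p ^ n) = rf_poly p ^ n"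
  by (induction n) (simp_all add: rf_poly_one rf_poly_mult)

lemma rf_poly_prod: "rf_poly (prod f A) = (\<Prod>u\<in>A. rf_poly (f u))"
  by (induction A rule: infinite_finite_induct) (simp_all add: rf_poly_one rf_poly_mult)

lemma field_hom_rf_const: "field_hom rf_const"
  by (simp add: field_hom_def rf_const_eq_rf_poly single_add rf_poly_one
        rf_poly_add[symmetric] rf_poly_mult[symmetric] mult_single)

lemma ratfun_cases:
  obtains p q where "q \<noteq> 0" "(u :: 'k::field ratfun) = rf_poly p / rf_poly q"
  by (metis Fract_eq_rf_poly_divide Fract_cases)

lemma single_var_power:
  "Poly_Mapping.single (Poly_Mapping.single l 1) (1::'k::field) ^ n = Poly_Mapping.single (Poly_Mapping.single l n) 1"
  by (induction n) (simp_all add: mult_single single_add[symmetric])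

lemma prod_single:
  "(\<Prod>l\<in>A. Poly_Mapping.single (f l :: nat \<Rightarrow>\<^sub>0 nat) (1::'k::field)) = Poly_Mapping.single (\<Sum>l\<in>A. f l) 1"
  by (induction A rule: infinite_finite_induct) (simp_all add: mult_single)

text \<open>Views a polynomial as its own value at the variables, which puts it in any subfield
  containing the constants and the variables that occur.\<close>

lemma rf_poly_eq_hom_eval: "rf_poly p = hom_eval rf_const rf_var p"
proof -
  have mono: "rf_poly (Poly_Mapping.single m z) = rf_const z * monom_eval rf_var m" for m and z :: 'a
  proof -
    have "Poly_Mapping.single m z = Poly_Mapping.single 0 z *
        (\<Prod>l\<in>Poly_Mapping.keys m. Poly_Mapping.single (Poly_Mapping.single l 1) 1 ^ Poly_Mapping.lookup m l)"
      unfolding single_var_power prod_single poly_mapping_eq_sum_single[of m, symmetric]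
      by (simp add: mult_single)
    thus ?thesis
      by (simp only: rf_poly_mult rf_poly_prod rf_poly_power rf_const_eq_rf_poly rf_var_eq_rf_poly
            monom_eval_def)
  qed
  show ?thesis
    unfolding hom_eval_def mono[symmetric] rf_poly_sum[symmetric]
      poly_mapping_eq_sum_single[of p, symmetric] ..
qed

lemma rf_poly_in_rf_field: "vars_below n p \<Longrightarrow> rf_poly p \<in> rf_field n"
proof -
  assume p: "vars_below n p"
  have sub: "is_subfield (rf_field n)" unfolding rf_field_def by (rule is_subfield_gen_field)
  have "rf_const z \<in> rf_field n" "l < n \<Longrightarrow> rf_var l \<in> rf_field n" for z :: 'a and l
    using gen_field_superset[of "range rf_const \<union> rf_var ` {..<n}"] unfolding rf_field_def by auto
  with p show ?thesis
    unfolding rf_poly_eq_hom_eval hom_eval_def monom_eval_def vars_below_def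
    by (intro subfield_sum[OF sub] subfield_mult[OF sub] subfield_prod[OF sub] subfield_power[OF sub]) auto
qed

text \<open>Multiplying by the common denominator Q turns both equations into polynomial identities,
  which are evaluated at a point where Q does not vanish and divided by Q^2.\<close>

lemma specialize_conic_pair:
  fixes x1 x2 x3 x4 :: "'k::field ratfun"
  assumes inf: "infinite (UNIV :: 'k set)"
    and eq1: "x1\<^sup>2 - rf_const a * x2\<^sup>2 = rf_const b"
    and eq2: "x3\<^sup>2 - rf_const a * x4\<^sup>2 = 2 * rf_const c * x1 + rf_const d"
  shows "\<exists>\<alpha> \<beta> \<gamma> \<delta>. \<alpha>\<^sup>2 - a * \<beta>\<^sup>2 = b \<and> \<gamma>\<^sup>2 - a * \<delta>\<^sup>2 = 2 * c * \<alpha> + d"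
proof -
  obtain p1 q1 where x1: "q1 \<noteq> 0" "x1 = rf_poly p1 / rf_poly q1" by (rule ratfun_cases)
  obtain p2 q2 where x2: "q2 \<noteq> 0" "x2 = rf_poly p2 / rf_poly q2" by (rule ratfun_cases)
  obtain p3 q3 where x3: "q3 \<noteq> 0" "x3 = rf_poly p3 / rf_poly q3" by (rule ratfun_cases)
  obtain p4 q4 where x4: "q4 \<noteq> 0" "x4 = rf_poly p4 / rf_poly q4" by (rule ratfun_cases)
  define Q where "Q = q1 * q2 * q3 * q4"
  define P1 where "P1 = p1 * q2 * q3 * q4"
  define P2 where "P2 = p2 * q1 * q3 * q4"
  define P3 where "P3 = p3 * q1 * q2 * q4"
  define P4 where "P4 = p4 * q1 * q2 * q3"
  define C where "C z = Poly_Mapping.single (0 :: nat \<Rightarrow>\<^sub>0 nat) z" for z :: 'k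
  have Q0: "Q \<noteq> 0" using x1 x2 x3 x4 by (simp add: Q_def)
  have X: "rf_poly P1 = x1 * rf_poly Q" "rf_poly P2 = x2 * rf_poly Q"
     "rf_poly P3 = x3 * rf_poly Q" "rf_poly P4 = x4 * rf_poly Q"
    using x1(1) x2(1) x3(1) x4(1)
    unfolding Q_def P1_def P2_def P3_def P4_def x1(2) x2(2) x3(2) x4(2)
    by (simp_all add: rf_poly_mult rf_poly_eq_0_iff)
  have two: "rf_const (2::'k) = 2"
    using field_hom_numeral[OF field_hom_rf_const, of "num.Bit0 num.One"] by simp
  have C: "rf_poly (C z) = rf_const z" for z
    by (simp add: C_def rf_const_eq_rf_poly)
  have "rf_poly (P1\<^sup>2 - C a * P2\<^sup>2) = rf_poly (C b * Q\<^sup>2)"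
    unfolding rf_poly_diff rf_poly_mult rf_poly_power X C eq1[symmetric]
    by (simp add: power_mult_distrib algebra_simps)
  hence 1: "P1\<^sup>2 - C a * P2\<^sup>2 = C b * Q\<^sup>2" by (simp add: rf_poly_eq_iff)
  have "rf_poly (P3\<^sup>2 - C a * P4\<^sup>2) = (x3\<^sup>2 - rf_const a * x4\<^sup>2) * (rf_poly Q)\<^sup>2"
    unfolding rf_poly_diff rf_poly_mult rf_poly_power X C
    by (simp add: power_mult_distrib algebra_simps)
  also have "\<dots> = rf_poly (C 2 * C c * P1 * Q + C d * Q\<^sup>2)"
    unfolding eq2 rf_poly_add rf_poly_mult rf_poly_power X C two
    by (simp add: power2_eq_square algebra_simps)
  finally have "rf_poly (P3\<^sup>2 - C a * P4\<^sup>2) = rf_poly (C 2 * C c * P1 * Q + C d * Q\<^sup>2)" .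
  hence 2: "P3\<^sup>2 - C a * P4\<^sup>2 = C 2 * C c * P1 * Q + C d * Q\<^sup>2" by (simp add: rf_poly_eq_iff)
  obtain v where v: "hom_eval (\<lambda>z. z) v Q \<noteq> 0" using ex_nonzero_hom_eval[OF inf Q0] by blast
  define h where "h = hom_eval (\<lambda>z::'k. z) v"
  have h: "h (p + q) = h p + h q" "h (p - q) = h p - h q" "h (p * q) = h p * h q" "h (C z) = z"
      "h (p\<^sup>2) = (h p)\<^sup>2" for p q z
    by (simp_all add: h_def C_def hom_eval_add hom_eval_diff hom_eval_mult hom_eval_const
          field_hom_id power2_eq_square)
  have hQ: "h Q \<noteq> 0" using v by (simp add: h_def)
  have 3: "(h P1)\<^sup>2 - a * (h P2)\<^sup>2 = b * (h Q)\<^sup>2" using arg_cong[OF 1, of h] by (simp only: h)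
  have 4: "(h P3)\<^sup>2 - a * (h P4)\<^sup>2 = 2 * c * h P1 * h Q + d * (h Q)\<^sup>2"
    using arg_cong[OF 2, of h] by (simp only: h)
  have "(h P1 / h Q)\<^sup>2 - a * (h P2 / h Q)\<^sup>2 = ((h P1)\<^sup>2 - a * (h P2)\<^sup>2) / (h Q)\<^sup>2"
    by (simp add: power_divide diff_divide_distrib)
  moreover have "(h P3 / h Q)\<^sup>2 - a * (h P4 / h Q)\<^sup>2 = ((h P3)\<^sup>2 - a * (h P4)\<^sup>2) / (h Q)\<^sup>2"
    by (simp add: power_divide diff_divide_distrib)
  moreover have "(2 * c * h P1 * h Q + d * (h Q)\<^sup>2) / (h Q)\<^sup>2 = 2 * c * (h P1 / h Q) + d"
    using hQ by (simp add: add_divide_distrib power2_eq_square)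
  ultimately have "(h P1 / h Q)\<^sup>2 - a * (h P2 / h Q)\<^sup>2 = b \<and>
      (h P3 / h Q)\<^sup>2 - a * (h P4 / h Q)\<^sup>2 = 2 * c * (h P1 / h Q) + d"
    unfolding 3 4 using hQ by simp
  thus ?thesis by blast
qed

subsection \<open>Rational extensions and rational function fields\<close>

text \<open>L is stably rational with no new variables: \<open>rf_field 0\<close> is the copy of L
  formed by the constants.\<close>

lemma rational_over_imp_rf_field_0:
  fixes i :: "'k::field \<Rightarrow> 'L::field"
  assumes i: "field_hom i" and r: "rational_over (range i) (UNIV :: 'L set)"
  shows "rational_over (range (\<lambda>z. rf_const (i z) :: 'L ratfun)) (rf_field 0 :: 'L ratfun set)"
proof -
  let ?r = "rf_const :: 'L \<Rightarrow> 'L ratfun"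
  obtain n x where ind: "alg_indep (range i) x n"
    and gen: "gen_field (range i \<union> x ` {..<n}) = (UNIV :: 'L set)"
    using r unfolding rational_over_def by blast
  have rf0: "rf_field 0 = range ?r"
    unfolding rf_field_def
    using gen_field_least[OF _ is_subfield_range[OF field_hom_rf_const], of "range ?r"]
      gen_field_superset[of "range ?r"] by auto
  have ri: "field_hom (\<lambda>z. ?r (i z))" by (rule field_hom_comp[OF field_hom_rf_const i])
  have "alg_indep (range (\<lambda>z. ?r (i z))) (\<lambda>l. ?r (x l)) n"
    using ind unfolding alg_indep_range_iff[OF i] alg_indep_range_iff[OF ri]
      hom_eval_hom[OF field_hom_rf_const] field_hom_eq_0_iff[OF field_hom_rf_const] .
  moreover have "gen_field (range (\<lambda>z. ?r (i z)) \<union> (\<lambda>l. ?r (x l)) ` {..<n}) = rf_field 0"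
    using gen_field_image[OF field_hom_rf_const, of "range i \<union> x ` {..<n}"]
    unfolding gen rf0 by (simp add: image_Un image_image)
  moreover have "\<forall>l<n. ?r (x l) \<in> rf_field 0" unfolding rf0 by blast
  ultimately show ?thesis
    unfolding rational_over_def by (intro exI[of _ n] exI[of _ "\<lambda>l. ?r (x l)"] conjI)
qed

text \<open>The inverse of evaluation at algebraically independent elements; it is only specified on the
  field that they generate.\<close>
lemma ex_hom_gen_field_to_rf_field:
  fixes j :: "'k::field \<Rightarrow> 'b::field"
  assumes j: "field_hom j" and ind: "alg_indep (range j) x n"
  defines "E \<equiv> gen_field (range j \<union> x ` {..<n})"
  shows "\<exists>f :: 'b \<Rightarrow> 'k ratfun. (\<forall>z. f (j z) = rf_const z) \<and> f ` E \<subseteq> rf_field n \<and>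
    (\<forall>u\<in>E. \<forall>v\<in>E. f (u + v) = f u + f v \<and> f (u * v) = f u * f v)"
proof -
  let ?ev = "hom_eval j x"
  \<comment> \<open>The polynomials p and q represent u as a fraction. The representable elements
    form a subfield containing the generators, hence all of E.\<close>
  define rep where "rep u p q \<longleftrightarrow> vars_below n p \<and> vars_below n q \<and> q \<noteq> 0 \<and> u = ?ev p / ?ev q" for u p q
  have ev0: "p = 0" if "vars_below n p" "?ev p = 0" for p
    using ind that unfolding alg_indep_range_iff[OF j] by blast
  have evne: "?ev q \<noteq> 0" if "rep u p q" for u p q
    using that ev0 unfolding rep_def by blast
  have rep_add: "rep (u + v) (p * q' + p' * q) (q * q')" and rep_mult: "rep (u * v) (p * p') (q * q')"
    if "rep u p q" "rep v p' q'" for u v p q p' q'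
    using that evne[OF that(1)] evne[OF that(2)] unfolding rep_def
    by (auto simp: vars_below_add vars_below_mult hom_eval_add[OF j] hom_eval_mult[OF j] add_frac_eq)
  have rep_const: "rep (j z) (Poly_Mapping.single 0 z) 1" for z
    by (simp add: rep_def vars_below_const vars_below_one hom_eval_const[OF j] hom_eval_one[OF j])
  have rep_uminus: "rep (- u) (- p) q" if "rep u p q" for u p q
    using that by (simp add: rep_def vars_below_uminus hom_eval_uminus[OF j])
  have rep_inverse: "\<exists>p q. rep (inverse u) p q" if u: "rep u p q" for u p q
  proof (cases "p = 0")
    \<comment> \<open>Since \<open>inverse 0 = 0\<close>, the inverse is again represented by 0 /
      1.\<close>
    case True
    hence "u = j 0" using u by (simp add: rep_def hom_eval_zero field_hom_zero[OF j])
    thus ?thesis using rep_const[of 0] by (auto simp: field_hom_zero[OF j])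
  next
    case False
    hence "rep (inverse u) q p" using u by (simp add: rep_def)
    thus ?thesis by blast
  qed
  have "E \<subseteq> {u. \<exists>p q. rep u p q}"
    unfolding E_def
  proof (rule gen_field_least)
    have "rep (x l) (Poly_Mapping.single (Poly_Mapping.single l 1) 1) 1" if "l < n" for l
      using that by (simp add: rep_def vars_below_single vars_below_one hom_eval_var[OF j, simplified] hom_eval_one[OF j])
    thus "range j \<union> x ` {..<n} \<subseteq> {u. \<exists>p q. rep u p q}" using rep_const by blast
    show "is_subfield {u. \<exists>p q. rep u p q}"
      unfolding is_subfield_def
    proof (intro conjI ballI)
      show "0 \<in> {u. \<exists>p q. rep u p q}" "1 \<in> {u. \<exists>p q. rep u p q}"
        using rep_const[of 0] rep_const[of 1] by (auto simp: field_hom_zero[OF j] field_hom_one[OF j])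
    next
      fix u v assume "u \<in> {u. \<exists>p q. rep u p q}" "v \<in> {u. \<exists>p q. rep u p q}"
      then obtain p q p' q' where "rep u p q" "rep v p' q'" by auto
      from rep_add[OF this] rep_mult[OF this]
      show "u + v \<in> {u. \<exists>p q. rep u p q}" "u * v \<in> {u. \<exists>p q. rep u p q}" by blast+
    next
      fix u assume "u \<in> {u. \<exists>p q. rep u p q}"
      then obtain p q where "rep u p q" by auto
      from rep_uminus[OF this] rep_inverse[OF this]
      show "- u \<in> {u. \<exists>p q. rep u p q}" "inverse u \<in> {u. \<exists>p q. rep u p q}" by blast+
    qed
  qed
  hence "\<forall>u\<in>E. \<exists>r. rep u (fst r) (snd r)" by fastforce
  from bchoice[OF this] obtain r where r: "\<forall>u\<in>E. rep u (fst (r u)) (snd (r u))" by blast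
  define num where "num u = fst (r u)" for u
  define den where "den u = snd (r u)" for u
  have nd: "rep u (num u) (den u)" if "u \<in> E" for u
    using r that by (simp add: num_def den_def)
  have den0: "den u \<noteq> 0" if "u \<in> E" for u
    using nd[OF that] by (simp add: rep_def)
  define f where "f u = rf_poly (num u) / rf_poly (den u)" for u
  \<comment> \<open>The value of f is independent of the chosen representation: cross multiplication
    gives a polynomial vanishing at x, hence zero by algebraic independence.\<close>
  have f: "f u = rf_poly p / rf_poly q" if u: "u \<in> E" and rep: "rep u p q" for u p q
  proof -
    have "?ev (num u * q - p * den u) = 0"
      using nd[OF u] rep evne[OF rep] evne[OF nd[OF u]] unfolding rep_def
      by (auto simp: hom_eval_diff[OF j] hom_eval_mult[OF j] frac_eq_eq)
    moreover have "vars_below n (num u * q - p * den u)"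
      using nd[OF u] rep unfolding rep_def diff_conv_add_uminus
      by (intro vars_below_add vars_below_uminus vars_below_mult) auto
    ultimately have "num u * q = p * den u" using ev0 by fastforce
    hence "rf_poly (num u) * rf_poly q = rf_poly p * rf_poly (den u)"
      by (simp only: rf_poly_mult[symmetric])
    moreover have "q \<noteq> 0" using rep by (simp add: rep_def)
    ultimately show ?thesis
      using den0[OF u] by (simp add: f_def frac_eq_eq rf_poly_eq_0_iff)
  qed
  have jE: "j z \<in> E" for z 
    using gen_field_superset[of "range j \<union> x ` {..<n}"] unfolding E_def by blast
  have sub: "is_subfield E" unfolding E_def by (rule is_subfield_gen_field)
  have "f (j z) = rf_const z" for z
    using f[OF jE rep_const] by (simp add: rf_const_eq_rf_poly rf_poly_one)
  moreover have "f u \<in> rf_field n" if "u \<in> E" for u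
  proof -
    have "rf_poly (num u) \<in> rf_field n" "rf_poly (den u) \<in> rf_field n"
      using nd[OF that] by (simp_all add: rep_def rf_poly_in_rf_field)
    thus ?thesis
      unfolding f_def rf_field_def by (rule subfield_divide[OF is_subfield_gen_field])
  qed
  moreover have "f (u + v) = f u + f v \<and> f (u * v) = f u * f v" if uv: "u \<in> E" "v \<in> E" for u v
  proof -
    have 1: "f (u + v) = rf_poly (num u * den v + num v * den u) / rf_poly (den u * den v)"
      by (rule f[OF subfield_add[OF sub uv] rep_add[OF nd[OF uv(1)] nd[OF uv(2)]]])
    have 2: "f (u * v) = rf_poly (num u * num v) / rf_poly (den u * den v)"
      by (rule f[OF subfield_mult[OF sub uv] rep_mult[OF nd[OF uv(1)] nd[OF uv(2)]]])
    show ?thesis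
      using den0[OF uv(1)] den0[OF uv(2)] unfolding 1 2 unfolding f_def
      by (simp add: rf_poly_mult rf_poly_add add_frac_eq rf_poly_eq_0_iff)
  qed
  ultimately show ?thesis by (intro exI[of _ f] conjI allI ballI image_subsetI) simp_all
qed

text \<open>The field L(y_1, ..., y_m) is identified with rational functions over k in its
  independent generators, and the identification is restricted to the constants L.\<close>

lemma stably_rational_imp_unirational:
  fixes i :: "'k::field \<Rightarrow> 'L::field"
  assumes i: "field_hom i"
    and r: "rational_over (range (\<lambda>z. rf_const (i z) :: 'L ratfun)) (rf_field m :: 'L ratfun set)"
  shows "\<exists>n (f :: 'L \<Rightarrow> 'k ratfun). field_hom f \<and> inj f \<and> (\<forall>z. f (i z) = rf_const z) \<and> range f \<subseteq> rf_field n"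
proof -
  let ?r = "rf_const :: 'L \<Rightarrow> 'L ratfun"
  let ?j = "\<lambda>z. ?r (i z)"
  have j: "field_hom ?j" by (rule field_hom_comp[OF field_hom_rf_const i])
  obtain n x where ind: "alg_indep (range ?j) x n"
    and gen: "gen_field (range ?j \<union> x ` {..<n}) = (rf_field m :: 'L ratfun set)"
    using r unfolding rational_over_def by blast
  from ex_hom_gen_field_to_rf_field[OF j ind, unfolded gen]
  obtain g :: "'L ratfun \<Rightarrow> 'k ratfun" where g_all: "(\<forall>z. g (?j z) = rf_const z) \<and> g ` rf_field m \<subseteq> rf_field n \<and>
      (\<forall>u\<in>rf_field m. \<forall>v\<in>rf_field m. g (u + v) = g u + g v \<and> g (u * v) = g u * g v)" ..
  have g: "g (?j z) = rf_const z" "g ` rf_field m \<subseteq> rf_field n"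
      "u \<in> rf_field m \<Longrightarrow> v \<in> rf_field m \<Longrightarrow> g (u + v) = g u + g v \<and> g (u * v) = g u * g v" for z u v
    using g_all by simp_all
  have mem: "?r u \<in> rf_field m" for u
    unfolding rf_field_def using gen_field_superset[of "range ?r \<union> rf_var ` {..<m}"] by blast
  have "g (?r 1) = 1"
    using g(1)[of 1] unfolding field_hom_one[OF i] field_hom_one[OF field_hom_rf_const] .
  hence f: "field_hom (\<lambda>u. g (?r u))"
    using g(3)[OF mem mem]
    by (simp add: field_hom_def field_hom_add[OF field_hom_rf_const] field_hom_mult[OF field_hom_rf_const])
  have "range (\<lambda>u. g (?r u)) \<subseteq> rf_field n"
    using g(2) mem by blast
  with f field_hom_inj[OF f] g(1) show ?thesis
    by (intro exI[of _ n] exI[of _ "\<lambda>u. g (?r u)"] conjI allI)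
qed

subsection \<open>Algebraic relations between two elements\<close>

text \<open>A polynomial in two variables is given by exponent pairs and coefficients, the form
  suited to linear algebra on monomials.\<close>

definition pair_relation :: "('k::field \<Rightarrow> 'b::field) \<Rightarrow> 'b \<Rightarrow> 'b \<Rightarrow> (nat \<times> nat) set \<Rightarrow> (nat \<times> nat \<Rightarrow> 'k) \<Rightarrow> bool" where
  "pair_relation j y z T c \<longleftrightarrow> finite T \<and> (\<Sum>t\<in>T. j (c t) * (y ^ fst t * z ^ snd t)) = 0"

definition pair_indep :: "('k::field \<Rightarrow> 'b::field) \<Rightarrow> 'b \<Rightarrow> 'b \<Rightarrow> bool" where
  "pair_indep j y z \<longleftrightarrow> (\<forall>T c. pair_relation j y z T c \<longrightarrow> (\<forall>t\<in>T. c t = 0))"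

definition pair_monom :: "nat \<times> nat \<Rightarrow> nat \<Rightarrow>\<^sub>0 nat" where
  "pair_monom t = Poly_Mapping.single 0 (fst t) + Poly_Mapping.single 1 (snd t)"

lemma lookup_pair_monom:
  "Poly_Mapping.lookup (pair_monom t) 0 = fst t" "Poly_Mapping.lookup (pair_monom t) (Suc 0) = snd t"
  by (simp_all add: pair_monom_def lookup_add lookup_single)

lemma inj_pair_monom: "inj pair_monom"
  by (rule injI) (metis lookup_pair_monom prod_eqI)

lemma monom_eval_pair_monom: "monom_eval x (pair_monom t) = x 0 ^ fst t * x 1 ^ snd t"
  by (simp add: pair_monom_def monom_eval_add monom_eval_single)

lemma keys_pair_monom: "Poly_Mapping.keys (pair_monom t) \<subseteq> {..<2}"
  unfolding pair_monom_def
  by (rule order.trans[OF Poly_Mapping.keys_add]) (auto split: if_splits)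

lemma pair_monom_surj:
  assumes "Poly_Mapping.keys m \<subseteq> {..<2}"
  shows "pair_monom (Poly_Mapping.lookup m 0, Poly_Mapping.lookup m 1) = m"
proof (rule poly_mapping_eqI)
  fix l
  show "Poly_Mapping.lookup (pair_monom (Poly_Mapping.lookup m 0, Poly_Mapping.lookup m 1)) l = Poly_Mapping.lookup m l"
  proof (cases "l < 2")
    case True
    hence "l = 0 \<or> l = 1" by auto
    thus ?thesis by (auto simp: lookup_pair_monom)
  next
    case False
    hence "Poly_Mapping.lookup m l = 0" using assms by (auto simp: in_keys_iff)
    with False show ?thesis by (auto simp: pair_monom_def lookup_add lookup_single)
  qed
qed

lemma alg_indep_2_iff_pair_indep:
  assumes j: "field_hom j"
  shows "alg_indep (range j) x 2 \<longleftrightarrow> pair_indep j (x 0) (x 1)"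
  unfolding alg_indep_range_iff[OF j]
proof
  assume ind: "\<forall>p. vars_below 2 p \<and> hom_eval j x p = 0 \<longrightarrow> p = 0"
  show "pair_indep j (x 0) (x 1)"
    unfolding pair_indep_def
  proof (intro allI impI ballI)
    fix T c t
    assume rel: "pair_relation j (x 0) (x 1) T c" and t: "t \<in> T"
    have fin: "finite T" using rel by (simp add: pair_relation_def)
    define p where "p = (\<Sum>t\<in>T. Poly_Mapping.single (pair_monom t) (c t))"
    have "hom_eval j x p = 0"
      using rel by (simp add: p_def hom_eval_sum[OF j] hom_eval_single[OF j] monom_eval_pair_monom
          pair_relation_def)
    moreover have "vars_below 2 p"
      unfolding p_def vars_below_def
      using Poly_Mapping.keys_sum[of "\<lambda>t. Poly_Mapping.single (pair_monom t) (c t)" T]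
      by (auto split: if_splits dest!: subsetD[OF keys_pair_monom] subsetD)
    ultimately have "p = 0" using ind by blast
    hence "0 = Poly_Mapping.lookup p (pair_monom t)" by simp
    also have "\<dots> = (\<Sum>t'\<in>T. if t' = t then c t' else 0)"
      unfolding p_def lookup_sum lookup_single
      by (intro sum.cong) (auto simp: when_def dest: injD[OF inj_pair_monom])
    also have "\<dots> = c t" using fin t by simp
    finally show "c t = 0" by simp
  qed
next
  assume ind: "pair_indep j (x 0) (x 1)"
  show "\<forall>p. vars_below 2 p \<and> hom_eval j x p = 0 \<longrightarrow> p = 0"
  proof (intro allI impI)
    fix p assume p: "vars_below 2 p \<and> hom_eval j x p = 0"
    define T where "T = pair_monom -` Poly_Mapping.keys p"
    have bij: "bij_betw pair_monom T (Poly_Mapping.keys p)"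
      unfolding bij_betw_def
    proof
      show "inj_on pair_monom T" using inj_pair_monom by (rule inj_on_subset) simp
      show "pair_monom ` T = Poly_Mapping.keys p"
      proof
        show "Poly_Mapping.keys p \<subseteq> pair_monom ` T"
        proof
          fix m assume m: "m \<in> Poly_Mapping.keys p"
          hence "Poly_Mapping.keys m \<subseteq> {..<2}" using p unfolding vars_below_def by blast
          from pair_monom_surj[OF this] m show "m \<in> pair_monom ` T"
            unfolding T_def by (metis image_eqI vimageI)
        qed
      qed (auto simp: T_def)
    qed
    define c where "c t = Poly_Mapping.lookup p (pair_monom t)" for t
    have "finite T" using bij by (simp add: bij_betw_finite)
    moreover have "(\<Sum>t\<in>T. j (c t) * (x 0 ^ fst t * x 1 ^ snd t)) = hom_eval j x p"
      unfolding hom_eval_def sum.reindex_bij_betw[OF bij, symmetric] by (simp add: c_def monom_eval_pair_monom)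
    ultimately have "pair_relation j (x 0) (x 1) T c" using p by (simp add: pair_relation_def)
    hence "\<forall>t\<in>T. c t = 0" using ind unfolding pair_indep_def by blast
    hence "T = {}" by (auto simp: T_def c_def in_keys_iff)
    hence "Poly_Mapping.keys p = {}" using bij by (simp add: bij_betw_def)
    thus "p = 0" by simp
  qed
qed

text \<open>Dimension count: with an algebraic relation between \<open>y\<close> and \<open>z\<close>, the monomials in \<open>y, z\<close> of
  degree at most \<open>M\<close> span a space of dimension linear in \<open>M\<close>. Hence the \<open>(n + 1)\<^sup>2\<close> monomials
  \<open>x0 ^ i * x1 ^ j\<close> with \<open>i, j \<le> n\<close> in two elements of the field \<open>k(y, z)\<close>, multiplied by a common
  denominator, are linearly dependent for large \<open>n\<close>.\<close>

locale related_generators =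
  fixes j :: "'k::field \<Rightarrow> 'b::field" and y z :: 'b and T :: "(nat \<times> nat) set" and c :: "nat \<times> nat \<Rightarrow> 'k"
  assumes j: "field_hom j" and rel: "pair_relation j y z T c" and nontriv: "\<exists>t\<in>T. c t \<noteq> 0"
begin

text \<open>The target field is a k-vector space through \<open>j\<close>, so dimension bounds apply
  to it.\<close>

sublocale V: vector_space "\<lambda>u v. j u * v"
  by unfold_locales
     (simp_all add: distrib_left distrib_right field_hom_add[OF j] field_hom_mult[OF j] field_hom_one[OF j] mult.assoc)

definition mon :: "nat \<times> nat \<Rightarrow> 'b" where "mon t = y ^ fst t * z ^ snd t"

lemma mon_mult: "mon t * mon t' = mon (fst t + fst t', snd t + snd t')"
  by (simp add: mon_def power_add mult_ac)

definition VM :: "nat \<Rightarrow> 'b set" where "VM M = V.span (mon ` {t. fst t + snd t \<le> M})"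

text \<open>Solves the relation for its leading monomial, ordered by total degree and then by the
  exponent of y.\<close>

lemma ex_leading_monomial:
  obtains p q T' c' where "finite T'" "mon (p, q) = (\<Sum>t\<in>T'. j (c' t) * mon t)"
    "\<And>t. t \<in> T' \<Longrightarrow> fst t + snd t < p + q \<or> (fst t + snd t = p + q \<and> fst t < p)"
proof -
  define T0 where "T0 = {t\<in>T. c t \<noteq> 0}"
  have fin: "finite T0" and ne: "T0 \<noteq> {}" using rel nontriv by (auto simp: T0_def pair_relation_def)
  have sum0: "(\<Sum>t\<in>T0. j (c t) * mon t) = 0"
  proof -
    have "(\<Sum>t\<in>T0. j (c t) * mon t) = (\<Sum>t\<in>T. j (c t) * mon t)"
      using rel by (intro sum.mono_neutral_left) (auto simp: T0_def pair_relation_def field_hom_zero[OF j])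
    thus ?thesis using rel by (simp add: pair_relation_def mon_def)
  qed
  define M where "M = Max ((\<lambda>t. fst t + snd t) ` T0)"
  have M: "fst t + snd t \<le> M" if "t \<in> T0" for t unfolding M_def using fin that by (intro Max_ge) auto
  have "M \<in> (\<lambda>t. fst t + snd t) ` T0" unfolding M_def using fin ne by (intro Max_in) auto
  define T1 where "T1 = {t\<in>T0. fst t + snd t = M}"
  have fin1: "finite T1" using fin by (simp add: T1_def)
  have ne1: "T1 \<noteq> {}" using \<open>M \<in> _\<close> unfolding T1_def by blast
  define p where "p = Max (fst ` T1)"
  have p: "fst t \<le> p" if "t \<in> T1" for t unfolding p_def using fin1 that by (intro Max_ge) auto
  have "p \<in> fst ` T1" unfolding p_def using fin1 ne1 by (intro Max_in) auto
  then obtain q where pq: "(p, q) \<in> T1" by auto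
  hence pqM: "p + q = M" "(p, q) \<in> T0" by (auto simp: T1_def)
  define c' where "c' t = - c t / c (p, q)" for t
  have cpq: "c (p, q) \<noteq> 0" using pqM by (simp add: T0_def)
  have "j (c (p, q)) * mon (p, q) = - (\<Sum>t\<in>T0 - {(p, q)}. j (c t) * mon t)"
    using sum0 sum.remove[OF fin pqM(2), of "\<lambda>t. j (c t) * mon t"]
    by (simp add: eq_neg_iff_add_eq_0)
  hence "mon (p, q) = - (\<Sum>t\<in>T0 - {(p, q)}. j (c t) * mon t) / j (c (p, q))"
    using cpq by (simp add: field_hom_eq_0_iff[OF j] field_simps)
  also have "\<dots> = (\<Sum>t\<in>T0 - {(p, q)}. j (c' t) * mon t)"
    by (simp add: c'_def field_hom_divide[OF j] field_hom_uminus[OF j] sum_divide_distrib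
          sum_negf[symmetric] del: sum_negf)
  finally have "mon (p, q) = (\<Sum>t\<in>T0 - {(p, q)}. j (c' t) * mon t)" .
  moreover have "fst t + snd t < p + q \<or> (fst t + snd t = p + q \<and> fst t < p)"
    if t: "t \<in> T0 - {(p, q)}" for t
  proof (cases "fst t + snd t = p + q")
    case True
    hence "fst t \<le> p" using t pqM by (intro p) (simp add: T1_def)
    moreover have "fst t \<noteq> p" using True t by (cases t) auto
    ultimately show ?thesis using True by simp
  next
    case False
    thus ?thesis using M[of t] t pqM by simp
  qed
  ultimately show ?thesis using that[of "T0 - {(p, q)}" p q c'] fin by blast
qed

text \<open>Rewriting with the leading monomial y^p z^q leaves the monomials not divisible by it.
  Those of degree at most M lie in p columns and q rows of length M + 1, so K = p + q works.\<close>

lemma ex_linear_span_bound: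
  obtains K where "\<And>M. \<exists>B. finite B \<and> card B \<le> K * (M + 1) \<and> VM M \<subseteq> V.span B"
proof -
  obtain p q T' c' where T': "finite T'" "mon (p, q) = (\<Sum>t\<in>T'. j (c' t) * mon t)"
    and less: "\<And>t. t \<in> T' \<Longrightarrow> fst t + snd t < p + q \<or> (fst t + snd t = p + q \<and> fst t < p)"
    by (rule ex_leading_monomial) blast
  define B where "B M = mon ` {t. fst t + snd t \<le> M \<and> (fst t < p \<or> snd t < q)}" for M
  have mono: "V.span (B M) \<subseteq> V.span (B N)" if "M \<le> N" for M N
    using that by (intro V.span_mono) (auto simp: B_def)
  have red: "mon t \<in> V.span (B (fst t + snd t))" for t
  \<comment> \<open>Each rewriting step lowers the monomial in the order of the leading
    monomial.\<close>
  proof (induction t rule: wf_induct[OF wf_measures[of "[\<lambda>t. fst t + snd t, fst]"]])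
    case (1 t)
    show ?case
    proof (cases "fst t < p \<or> snd t < q")
      case True
      thus ?thesis by (intro V.span_base) (auto simp: B_def)
    next
      case False
      define r where "r = (fst t - p, snd t - q)"
      have "mon t = mon r * mon (p, q)" using False by (simp add: mon_mult r_def)
      also have "\<dots> = (\<Sum>s\<in>T'. j (c' s) * mon (fst r + fst s, snd r + snd s))"
        unfolding T'(2) sum_distrib_left by (simp add: mon_mult[symmetric] mult_ac)
      also have "\<dots> \<in> V.span (B (fst t + snd t))"
      proof (intro V.span_sum V.span_scale)
        fix s assume s: "s \<in> T'"
        let ?u = "(fst r + fst s, snd r + snd s)"
        have lt: "fst ?u + snd ?u < fst t + snd t \<or> (fst ?u + snd ?u = fst t + snd t \<and> fst ?u < fst t)"
          using less[OF s] False by (auto simp: r_def)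
        hence "mon ?u \<in> V.span (B (fst ?u + snd ?u))"
          using 1[rule_format, of ?u] by (auto simp: in_measures)
        moreover have "fst ?u + snd ?u \<le> fst t + snd t" using lt by linarith
        ultimately show "mon ?u \<in> V.span (B (fst t + snd t))" using mono by blast
      qed
      finally show ?thesis .
    qed
  qed
  have "\<exists>B'. finite B' \<and> card B' \<le> (p + q) * (M + 1) \<and> VM M \<subseteq> V.span B'" for M
  proof (intro exI[of _ "B M"] conjI)
    let ?I = "{..<p} \<times> {..M} \<union> {..M} \<times> {..<q}"
    have sub: "B M \<subseteq> mon ` ?I" unfolding B_def by (intro image_mono) auto
    show fin: "finite (B M)" by (rule finite_subset[OF sub]) simp
    have "card (B M) \<le> card (mon ` ?I)" by (rule card_mono[OF _ sub]) simp
    also have "\<dots> \<le> card ?I" by (rule card_image_le) simp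
    also have "\<dots> \<le> card ({..<p} \<times> {..M}) + card ({..M} \<times> {..<q})" by (rule card_Un_le)
    also have "\<dots> = (p + q) * (M + 1)" by (simp add: algebra_simps)
    finally show "card (B M) \<le> (p + q) * (M + 1)" .
    have "mon t \<in> V.span (B M)" if "fst t + snd t \<le> M" for t
      using red[of t] mono[OF that] by blast
    thus "VM M \<subseteq> V.span (B M)"
      unfolding VM_def by (intro V.span_minimal) auto
  qed
  thus ?thesis by (rule that)
qed

lemma VM_mono: "M \<le> N \<Longrightarrow> VM M \<subseteq> VM N"
  unfolding VM_def by (intro V.span_mono) auto

lemma mon_in_VM: "fst t + snd t \<le> M \<Longrightarrow> mon t \<in> VM M"
  unfolding VM_def by (intro V.span_base) auto

lemma const_in_VM: "j u \<in> VM M"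
  using V.span_scale[OF mon_in_VM[of "(0, 0)" M, unfolded VM_def], of u]
  by (simp add: VM_def mon_def)

lemma VM_subspace: "V.subspace (VM M)"
  unfolding VM_def by simp

lemma VM_mult:
  assumes u: "u \<in> VM M" and v: "v \<in> VM N" shows "u * v \<in> VM (M + N)"
proof -
  have 1: "mon t * v \<in> VM (M + N)" if t: "fst t + snd t \<le> M" for t
    using v unfolding VM_def[of N]
  proof (induction rule: V.span_induct_alt)
    case base
    show ?case using V.subspace_0[OF VM_subspace] by simp
  next
    case (step a v' w)
    then obtain s where s: "v' = mon s" "fst s + snd s \<le> N" by auto
    have "mon t * mon s \<in> VM (M + N)" using t s by (simp add: mon_mult mon_in_VM)
    from V.subspace_add[OF VM_subspace V.subspace_scale[OF VM_subspace this, of a] step(2)]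
    show ?case by (simp add: s algebra_simps)
  qed
  show ?thesis
    using u unfolding VM_def[of M]
  proof (induction rule: V.span_induct_alt)
    case base
    show ?case using V.subspace_0[OF VM_subspace] by simp
  next
    case (step a u' w)
    then obtain s where s: "u' = mon s" "fst s + snd s \<le> M" by auto
    from V.subspace_add[OF VM_subspace V.subspace_scale[OF VM_subspace 1[OF s(2)], of a] step(2)]
    show ?case by (simp add: s algebra_simps)
  qed
qed

lemma VM_power: "u \<in> VM M \<Longrightarrow> u ^ n \<in> VM (n * M)"
proof (induction n)
  case 0
  show ?case using const_in_VM[of 1 0] by (simp add: field_hom_one[OF j])
next
  case (Suc n)
  thus ?case using VM_mult[of u M "u ^ n" "n * M"] by simp
qed

text \<open>Quotients of polynomial expressions in y and z form a subfield; a single M bounds the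
  degrees of both numerator and denominator.\<close>

lemma gen_field_subset_fractions:
  "gen_field (range j \<union> {y, z}) \<subseteq> {u / v | u v M. u \<in> VM M \<and> v \<in> VM M \<and> v \<noteq> 0}" (is "_ \<subseteq> ?D")
proof (rule gen_field_least)
  have 1: "1 \<in> VM M" for M using const_in_VM[of 1 M] by (simp add: field_hom_one[OF j])
  have D: "u / v \<in> ?D" if "u \<in> VM M" "v \<in> VM N" "v \<noteq> 0" for u v M N
  proof -
    have "u \<in> VM (max M N)" "v \<in> VM (max M N)"
      using that VM_mono[of M "max M N"] VM_mono[of N "max M N"] by auto
    thus ?thesis using that by blast
  qed
  have "y \<in> VM 1" "z \<in> VM 1" using mon_in_VM[of "(1, 0)" 1] mon_in_VM[of "(0, 1)" 1] by (auto simp: mon_def)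
  hence "y \<in> ?D" "z \<in> ?D" using D[OF _ 1] by fastforce+
  moreover have "j u \<in> ?D" for u using D[OF const_in_VM 1] by fastforce
  ultimately show "range j \<union> {y, z} \<subseteq> ?D" by blast
  show "is_subfield ?D"
    unfolding is_subfield_def
  proof (intro conjI ballI)
    show "0 \<in> ?D" "1 \<in> ?D"
      using D[OF const_in_VM[of 0] 1] D[OF 1 1] by (simp_all add: field_hom_zero[OF j])
  next
    fix a b assume "a \<in> ?D" "b \<in> ?D"
    then obtain u v M u' v' M' where a: "a = u / v" "u \<in> VM M" "v \<in> VM M" "v \<noteq> 0"
      and b: "b = u' / v'" "u' \<in> VM M'" "v' \<in> VM M'" "v' \<noteq> 0" by blast
    have vv: "v * v' \<in> VM (M + M')" "v * v' \<noteq> 0" using a b VM_mult by auto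
    have "u * v' + u' * v \<in> VM (M + M')"
      using V.subspace_add[OF VM_subspace VM_mult[OF a(2) b(3)]] VM_mult[OF b(2) a(3)] by (simp add: add.commute)
    from D[OF this vv] show "a + b \<in> ?D" using a b by (simp add: add_frac_eq)
    from D[OF VM_mult[OF a(2) b(2)] vv] show "a * b \<in> ?D" using a b by simp
  next
    fix a assume "a \<in> ?D"
    then obtain u v M where a: "a = u / v" "u \<in> VM M" "v \<in> VM M" "v \<noteq> 0" by blast
    show "- a \<in> ?D" using D[OF V.subspace_neg[OF VM_subspace a(2)] a(3,4)] a(1) by simp
    show "inverse a \<in> ?D"
    proof (cases "u = 0")
      case True
      thus ?thesis using D[OF const_in_VM[of 0] 1] a by (simp add: field_hom_zero[OF j])
    next
      case False
      thus ?thesis using D[OF a(3) a(2)] a(1) by simp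
    qed
  qed
qed

lemma not_pair_indep:
  assumes x0: "x0 \<in> gen_field (range j \<union> {y, z})" and x1: "x1 \<in> gen_field (range j \<union> {y, z})"
  shows "\<not> pair_indep j x0 x1"
proof
  assume ind: "pair_indep j x0 x1"
  obtain A' C' M where A': "x0 = A' / C'" "A' \<in> VM M" "C' \<in> VM M" "C' \<noteq> 0"
    using gen_field_subset_fractions x0 by blast
  obtain B' D' M' where B': "x1 = B' / D'" "B' \<in> VM M'" "D' \<in> VM M'" "D' \<noteq> 0"
    using gen_field_subset_fractions x1 by blast
  define E where "E = M + M'"
  define C where "C = C' * D'"
  define A where "A = A' * D'"
  define B where "B = B' * C'"
  have mem: "A \<in> VM E" "B \<in> VM E" "C \<in> VM E"
    unfolding A_def B_def C_def E_def using A' B' VM_mult[of _ M _ M'] VM_mult[of _ M' _ M]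
    by (auto simp: add.commute)
  have C0: "C \<noteq> 0" using A' B' by (simp add: C_def)
  have xs: "x0 = A / C" "x1 = B / C" using A' B' by (simp_all add: A_def B_def C_def)
  obtain K where K: "\<And>M. \<exists>B. finite B \<and> card B \<le> K * (M + 1) \<and> VM M \<subseteq> V.span B"
    by (rule ex_linear_span_bound) blast
  \<comment> \<open>Chosen so that K (2 n E + 1) <= n^2 + K < (n + 1)^2: the spanning set is smaller
    than the family of monomials.\<close>
  define n where "n = 2 * K * (E + 1)"
  \<comment> \<open>The factor C^(2n) clears the denominators of all monomials indexed by I at once,
    and each product has degree at most 2 n E in y and z.\<close>
  define f where "f t = C ^ (2 * n) * (x0 ^ fst t * x1 ^ snd t)" for t :: "nat \<times> nat"
  define I where "I = {..n} \<times> {..n}"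
  have finI: "finite I" by (simp add: I_def)
  have fV: "f t \<in> VM (2 * n * E)" if "t \<in> I" for t
  proof -
    have le: "fst t + snd t \<le> 2 * n" using that by (auto simp: I_def)
    hence "C ^ (2 * n) = C ^ fst t * C ^ snd t * C ^ (2 * n - (fst t + snd t))"
      by (simp flip: power_add)
    hence "f t = A ^ fst t * B ^ snd t * C ^ (2 * n - (fst t + snd t))"
      using C0 by (simp add: f_def xs power_divide)
    also have "\<dots> \<in> VM (fst t * E + snd t * E + (2 * n - (fst t + snd t)) * E)"
      by (intro VM_mult VM_power mem)
    also have "fst t * E + snd t * E + (2 * n - (fst t + snd t)) * E = 2 * n * E"
      using le by (simp flip: add_mult_distrib)
    finally show ?thesis .
  qed
  \<comment> \<open>Two equal values would already be a relation between x0 and x1; distinctness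
    gives the cardinality (n + 1)^2 of the family.\<close>
  have inj: "inj_on f I"
  proof (rule inj_onI, rule ccontr)
    fix s t assume "f s = f t" "s \<noteq> t"
    hence "x0 ^ fst s * x1 ^ snd s = x0 ^ fst t * x1 ^ snd t" using C0 by (simp add: f_def)
    hence "pair_relation j x0 x1 {s, t} (\<lambda>u. if u = s then 1 else - 1)"
      using \<open>s \<noteq> t\<close> by (simp add: pair_relation_def field_hom_one[OF j] field_hom_uminus[OF j])
    with ind have "(1 :: 'k) = 0" unfolding pair_indep_def by fastforce
    thus False by simp
  qed
  have "V.dependent (f ` I)"
  proof (rule ccontr)
    assume indep: "V.independent (f ` I)"
    obtain Bs where Bs: "finite Bs" "card Bs \<le> K * (2 * n * E + 1)" "VM (2 * n * E) \<subseteq> V.span Bs"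
      using K by blast
    have "f ` I \<subseteq> V.span Bs" using fV Bs(3) by blast
    from V.independent_span_bound[OF Bs(1) indep this] have "card (f ` I) \<le> card Bs" by simp
    also have "card (f ` I) = (n + 1) * (n + 1)"
      unfolding card_image[OF inj] by (simp add: I_def card_cartesian_product)
    finally have "(n + 1) * (n + 1) \<le> K * (2 * n * E + 1)" using Bs(2) by simp
    moreover have "K * (2 * n * E + 1) < (n + 1) * (n + 1)"
    proof -
      have "K * (2 * n * E + 1) \<le> n * n + K"
        by (simp add: n_def algebra_simps)
      also have "K \<le> n" by (simp add: n_def)
      also have "n * n + n < (n + 1) * (n + 1)" by simp
      finally show ?thesis by simp
    qed
    ultimately show False by simp
  qed
  then obtain g where g: "\<exists>v\<in>f ` I. g v \<noteq> 0" "(\<Sum>v\<in>f ` I. j (g v) * v) = 0"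
    using V.dependent_finite[of "f ` I"] finI by auto
  have "C ^ (2 * n) * (\<Sum>t\<in>I. j (g (f t)) * (x0 ^ fst t * x1 ^ snd t)) = 0"
    using g(2) unfolding sum.reindex[OF inj] by (simp add: f_def sum_distrib_left mult_ac)
  hence "pair_relation j x0 x1 I (\<lambda>t. g (f t))"
    using C0 finI by (simp add: pair_relation_def)
  with ind g(1) show False unfolding pair_indep_def by blast
qed

end

section \<open>Two generators of a field of transcendence degree 2\<close>

lemma pair_indep_generators:
  fixes j :: "'k::field \<Rightarrow> 'b::field"
  assumes j: "field_hom j" and gen: "gen_field (range j \<union> {y, z}) = UNIV"
    and tr: "trdeg_eq (range j) (UNIV :: 'b set) 2"
  shows "pair_indep j y z"
proof (rule ccontr)
  assume "\<not> pair_indep j y z"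
  then obtain T c where "pair_relation j y z T c" "\<exists>t\<in>T. c t \<noteq> 0" unfolding pair_indep_def by blast
  then interpret related_generators j y z T c by unfold_locales (use j in auto)
  obtain x where "alg_indep (range j) x 2" using tr unfolding trdeg_eq_def by blast
  hence "pair_indep j (x 0) (x 1)" by (simp add: alg_indep_2_iff_pair_indep[OF j])
  with not_pair_indep[of "x 0" "x 1"] show False unfolding gen by blast
qed

text \<open>In transcendence degree 2 any two generators are automatically independent, so
  rationality reduces to finding two generators.\<close>

lemma rational_over_two_generators:
  fixes j :: "'k::field \<Rightarrow> 'b::field"
  assumes j: "field_hom j" and gen: "gen_field (range j \<union> {y, z}) = UNIV"
    and tr: "trdeg_eq (range j) (UNIV :: 'b set) 2"
  shows "rational_over (range j) (UNIV :: 'b set)"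
proof -
  define x where "x l = (if l = 0 then y else z)" for l :: nat
  have "alg_indep (range j) x 2"
    using pair_indep_generators[OF assms] by (simp add: alg_indep_2_iff_pair_indep[OF j] x_def)
  moreover have "x ` {..<2} = {y, z}" by (auto simp: x_def lessThan_nat_numeral lessThan_Suc)
  ultimately show ?thesis unfolding rational_over_def using gen by (intro exI[of _ 2] exI[of _ x]) auto
qed

text \<open>Excludes the degenerate positions in the parametrization below; the value a = 0 is
  allowed and excludes a constant square y^2.\<close>

lemma no_binary_quadratic_relation:
  fixes j :: "'k::field \<Rightarrow> 'b::field"
  assumes j: "field_hom j" and gen: "gen_field (range j \<union> {y, z}) = UNIV"
    and tr: "trdeg_eq (range j) (UNIV :: 'b set) 2"
  shows "y\<^sup>2 - j a * z\<^sup>2 \<noteq> j b"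
proof
  assume eq: "y\<^sup>2 - j a * z\<^sup>2 = j b"
  define c where "c t = (if t = (2, 0) then 1 else if t = (0, 2) then - a else - b)" for t :: "nat \<times> nat"
  have "pair_relation j y z {(2, 0), (0, 2), (0, 0)} c"
    unfolding pair_relation_def
    by (simp add: c_def field_hom_one[OF j] field_hom_uminus[OF j] eq[symmetric])
  hence "c (2, 0) = 0" using pair_indep_generators[OF assms] unfolding pair_indep_def by blast
  thus False by (simp add: c_def)
qed

subsection \<open>Parametrization from a rational point\<close>

text \<open>With s the slope of the line from (\<alpha>, \<beta>) to the generic point (t1, t2), L
  is generated by s and the projected coordinates x, y. The equation of the quadric is linear in s,
  so s is eliminated unless its coefficient m vanishes, and m = 0 contradicts the transcendence
  degree.\<close>

lemma rational_over_of_rational_point: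
  fixes a b c d \<alpha> \<beta> \<gamma> \<delta> :: "'k::field" and i :: "'k \<Rightarrow> 'L::field"
  assumes two: "(2::'k) \<noteq> 0" and a: "\<not> (\<exists>r. r\<^sup>2 = a)" and b: "\<not> (\<exists>r. r\<^sup>2 = b)"
    and cd: "c \<noteq> 0 \<or> d \<noteq> 0" and i: "field_hom i"
    and gen: "gen_field (range i \<union> {t1, t2, t3, t4}) = UNIV"
    and tr: "trdeg_eq (range i) (UNIV :: 'L set) 2"
    and eq1: "t1\<^sup>2 - i a * t2\<^sup>2 = i b"
    and eq2: "t3\<^sup>2 - i a * t4\<^sup>2 = 2 * i c * t1 + i d"
    and ab: "\<alpha>\<^sup>2 - a * \<beta>\<^sup>2 = b" and gd: "\<gamma>\<^sup>2 - a * \<delta>\<^sup>2 = 2 * c * \<alpha> + d"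
  shows "rational_over (range i) (UNIV :: 'L set)"
proof -
  have b0: "i b \<noteq> 0" using b field_hom_eq_0_iff[OF i] by (metis zero_power2)
  have a0: "i a \<noteq> 0" using a field_hom_eq_0_iff[OF i] by (metis zero_power2)
  have i2: "i 2 = 2" by (rule field_hom_numeral[OF i])
  hence two': "(2::'L) \<noteq> 0" using two field_hom_eq_0_iff[OF i, of 2] by simp
  note hom = field_hom_add[OF i] field_hom_diff[OF i] field_hom_mult[OF i] field_hom_power[OF i] i2
  have ab': "(i \<alpha>)\<^sup>2 - i a * (i \<beta>)\<^sup>2 = i b" unfolding ab[symmetric] hom ..
  have gd': "(i \<gamma>)\<^sup>2 - i a * (i \<delta>)\<^sup>2 = 2 * i c * i \<alpha> + i d"
    using arg_cong[OF gd, of i] unfolding hom .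
  have genI: "gen_field (range i \<union> {y, z}) = UNIV"
    if "{t1, t2, t3, t4} \<subseteq> gen_field (range i \<union> {y, z})" for y z
    using gen_field_least[of "range i \<union> {t1, t2, t3, t4}" "gen_field (range i \<union> {y, z})"]
      gen_field_superset[of "range i \<union> {y, z}"] that is_subfield_gen_field unfolding gen by auto
  have mem: "is_subfield (gen_field (range i \<union> {y, z}))" "y \<in> gen_field (range i \<union> {y, z})"
      "z \<in> gen_field (range i \<union> {y, z})" "i u \<in> gen_field (range i \<union> {y, z})" for y z u
    using gen_field_superset[of "range i \<union> {y, z}"] is_subfield_gen_field by auto
  \<comment> \<open>Otherwise t2 is plus or minus \<open>i \<beta>\<close>, and L is generated by t3
    and t4, which satisfy a quadratic relation over k.\<close>
  have "t1 \<noteq> i \<alpha>"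
  proof
    assume t1: "t1 = i \<alpha>"
    hence "i a * (t2\<^sup>2 - (i \<beta>)\<^sup>2) = 0" using eq1 ab' by (simp add: algebra_simps)
    hence "t2\<^sup>2 = (i \<beta>)\<^sup>2" using a0 by simp
    hence "t2 = i \<beta> \<or> t2 = i (- \<beta>)" by (simp add: power2_eq_iff field_hom_uminus[OF i])
    hence "gen_field (range i \<union> {t3, t4}) = UNIV" using mem[where y = t3 and z = t4] t1 by (intro genI) auto
    moreover have "t3\<^sup>2 - i a * t4\<^sup>2 = i (2 * c * \<alpha> + d)" using eq2 t1 by (simp add: hom)
    ultimately show False using no_binary_quadratic_relation[OF i _ tr] by blast
  qed
  define s where "s = (t2 - i \<beta>) / (t1 - i \<alpha>)"
  define r where "r = t1 - i \<alpha>"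
  have r0: "r \<noteq> 0" using \<open>t1 \<noteq> i \<alpha>\<close> by (simp add: r_def)
  have t1: "t1 = i \<alpha> + r" by (simp add: r_def)
  have t2: "t2 = i \<beta> + s * r" using r0 by (simp add: s_def r_def)
  define n where "n = 1 - i a * s\<^sup>2"
  have "r * (r * n - (2 * i a * i \<beta> * s - 2 * i \<alpha>)) = 0"
    using eq1 unfolding ab'[symmetric] t1 t2 n_def by algebra
  hence rn: "r * n = 2 * i a * i \<beta> * s - 2 * i \<alpha>" using r0 by simp
  have n0: "n \<noteq> 0"
  proof
    assume n: "n = 0"
    hence "2 * (i a * i \<beta> * s - i \<alpha>) = 0" using rn
      by (simp only: right_diff_distrib mult.assoc mult_zero_right)
    hence "i \<alpha> = i a * i \<beta> * s" using two' by simp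
    moreover have "i a * s\<^sup>2 = 1" using n by (simp add: n_def)
    ultimately have "i b = 0" unfolding ab'[symmetric] by algebra
    with b0 show False ..
  qed
  have r: "r = (2 * i a * i \<beta> * s - 2 * i \<alpha>) / n" using rn n0 by (simp add: divide_simps)
  \<comment> \<open>Here \<open>X + Y \<surd>a = (t3 + t4 \<surd>a) (1 + s \<surd>a)\<close>, and \<open>X\<^sup>2 - a Y\<^sup>2\<close> is a quadratic
    polynomial in \<open>s\<close> with leading coefficient \<open>(a \<delta>)\<^sup>2 - a \<gamma>\<^sup>2\<close>; so \<open>x, y\<close> are the coordinates of the
    projection from the rational point at infinity \<open>(X : Y : s) = (a \<delta> : \<gamma> : 1)\<close> of the quadric.\<close>
  define x where "x = t3 + i a * s * t4 - i a * i \<delta> * s"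
  define y where "y = t4 + s * t3 - i \<gamma> * s"
  \<comment> \<open>Division of X + Y sqrt a by 1 + s sqrt a, whose norm is n.\<close>
  have t3: "t3 = ((x + i a * i \<delta> * s) - i a * s * (y + i \<gamma> * s)) / n"
    using n0 by (simp add: x_def y_def n_def field_simps power2_eq_square)
  have t4: "t4 = ((y + i \<gamma> * s) - s * (x + i a * i \<delta> * s)) / n"
    using n0 by (simp add: x_def y_def n_def field_simps power2_eq_square)
  have gens: "gen_field (range i \<union> {u, v}) = UNIV"
    if "s \<in> gen_field (range i \<union> {u, v})" "x \<in> gen_field (range i \<union> {u, v})"
      "y \<in> gen_field (range i \<union> {u, v})" for u v
  proof (rule genI)
    note cl = subfield_closed[OF mem(1)[of u v]] mem(4)[of _ u v] that
    have two_mem: "2 \<in> gen_field (range i \<union> {u, v})" using mem(4)[of 2 u v] by (simp only: i2)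
    have n_mem: "n \<in> gen_field (range i \<union> {u, v})" unfolding n_def by (intro cl)
    have r_mem: "r \<in> gen_field (range i \<union> {u, v})" unfolding r by (intro cl two_mem n_mem)
    have "t1 \<in> gen_field (range i \<union> {u, v})" "t2 \<in> gen_field (range i \<union> {u, v})"
      unfolding t1 t2 by (intro cl r_mem)+
    moreover have "t3 \<in> gen_field (range i \<union> {u, v})" unfolding t3 by (intro cl n_mem)
    moreover have "t4 \<in> gen_field (range i \<union> {u, v})" unfolding t4 by (intro cl n_mem)
    ultimately show "{t1, t2, t3, t4} \<subseteq> gen_field (range i \<union> {u, v})" by simp
  qed
  define m where "m = i \<delta> * x - i \<gamma> * y - 2 * i c * i \<beta>"
  have norm: "(x + i a * i \<delta> * s)\<^sup>2 - i a * (y + i \<gamma> * s)\<^sup>2 = (t3\<^sup>2 - i a * t4\<^sup>2) * n"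
    unfolding x_def y_def n_def by algebra
  \<comment> \<open>The coefficients of s^2 on both sides agree by \<open>gd'\<close>: the centre of
    projection lies on the quadric.\<close>
  have lin: "s * (2 * i a * m) = i d - 2 * i c * i \<alpha> - (x\<^sup>2 - i a * y\<^sup>2)"
  proof -
    have "(t3\<^sup>2 - i a * t4\<^sup>2) * n = (2 * i c * i \<alpha> + i d) * n + 2 * i c * (r * n)"
      unfolding eq2 t1 by algebra
    also have "\<dots> = (2 * i c * i \<alpha> + i d) * n + 2 * i c * (2 * i a * i \<beta> * s - 2 * i \<alpha>)"
      unfolding rn ..
    finally have "(x + i a * i \<delta> * s)\<^sup>2 - i a * (y + i \<gamma> * s)\<^sup>2
      = (2 * i c * i \<alpha> + i d) * n + 2 * i c * (2 * i a * i \<beta> * s - 2 * i \<alpha>)"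
      unfolding norm .
    thus ?thesis using gd' unfolding n_def m_def by algebra
  qed
  show ?thesis
  proof (cases "m = 0")
    case False
    have s: "s = (i d - 2 * i c * i \<alpha> - (x\<^sup>2 - i a * y\<^sup>2)) / (2 * i a * m)"
      using lin False a0 two' by (simp add: divide_simps)
    have two_mem: "2 \<in> gen_field (range i \<union> {x, y})" using mem(4)[of 2 x y] by (simp only: i2)
    have "s \<in> gen_field (range i \<union> {x, y})"
      unfolding s m_def by (intro subfield_closed[OF mem(1)] mem two_mem)
    hence "gen_field (range i \<union> {x, y}) = UNIV" by (intro gens mem)
    thus ?thesis by (rule rational_over_two_generators[OF i _ tr])
  next
    case True
    \<comment> \<open>If the norm vanished, then \<gamma> = \<delta> = 0 and m = 0 would give c
      \<beta> = 0; as b is not a square, \<beta> is non-zero, so c = 0 and then d = 0.\<close>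
    have \<gamma>\<delta>: "\<gamma>\<^sup>2 - a * \<delta>\<^sup>2 \<noteq> 0"
    proof
      assume 0: "\<gamma>\<^sup>2 - a * \<delta>\<^sup>2 = 0"
      hence "\<gamma> = 0" "\<delta> = 0" using norm_form_eq_0D[OF a] by blast+
      hence "i (2 * c * \<beta>) = 0" using True by (simp add: m_def hom field_hom_zero[OF i])
      hence "c = 0 \<or> \<beta> = 0" using two by (simp add: field_hom_eq_0_iff[OF i])
      moreover have "\<beta> \<noteq> 0" using ab b by auto
      ultimately show False using 0 gd cd by auto
    qed
    define e where "e = i (\<gamma>\<^sup>2 - a * \<delta>\<^sup>2)"
    have "e \<noteq> 0" using \<gamma>\<delta> unfolding e_def field_hom_eq_0_iff[OF i] .
    moreover have "e = (i \<gamma>)\<^sup>2 - i a * (i \<delta>)\<^sup>2" unfolding e_def hom ..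
    ultimately have e: "e \<noteq> 0" "e = (i \<gamma>)\<^sup>2 - i a * (i \<delta>)\<^sup>2" .
    \<comment> \<open>For m = 0, z + 2 c \<beta> sqrt a = (\<gamma> + \<delta> sqrt a) (x - y sqrt
      a). Hence z determines x and y, while taking norms shows that z^2 lies in k.\<close>
    define z where "z = i \<gamma> * x - i a * i \<delta> * y"
    have m: "i \<delta> * x - i \<gamma> * y = 2 * i c * i \<beta>" using True by (simp add: m_def)
    have "e * x = i \<gamma> * z - i a * i \<delta> * (2 * i c * i \<beta>)"
      unfolding m[symmetric] z_def e(2) by algebra
    hence x: "x = (i \<gamma> * z - i a * i \<delta> * i (2 * c * \<beta>)) / e" using e(1) by (simp add: divide_simps hom mult_ac)
    have "e * y = i \<delta> * z - i \<gamma> * (2 * i c * i \<beta>)"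
      unfolding m[symmetric] z_def e(2) by algebra
    hence y: "y = (i \<delta> * z - i \<gamma> * i (2 * c * \<beta>)) / e" using e(1) by (simp add: divide_simps hom mult_ac)
    have "gen_field (range i \<union> {z, s}) = UNIV"
    proof (rule gens)
      have em: "e \<in> gen_field (range i \<union> {z, s})" unfolding e_def by (rule mem)
      show "x \<in> gen_field (range i \<union> {z, s})" "y \<in> gen_field (range i \<union> {z, s})"
        unfolding x y by (intro subfield_closed[OF mem(1)] mem em)+
    qed (rule mem)
    moreover have "z\<^sup>2 - i 0 * s\<^sup>2 = i (a * (2 * c * \<beta>)\<^sup>2 + (\<gamma>\<^sup>2 - a * \<delta>\<^sup>2) * (d - 2 * c * \<alpha>))"
    proof -
      have "x\<^sup>2 - i a * y\<^sup>2 = i d - 2 * i c * i \<alpha>" using lin True by simp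
      hence "z\<^sup>2 = i a * (2 * i c * i \<beta>)\<^sup>2 + ((i \<gamma>)\<^sup>2 - i a * (i \<delta>)\<^sup>2) * (i d - 2 * i c * i \<alpha>)"
        unfolding m[symmetric] z_def by algebra
      thus ?thesis by (simp only: hom field_hom_zero[OF i] mult_zero_left diff_zero)
    qed
    ultimately show ?thesis using no_binary_quadratic_relation[OF i _ tr] by blast
  qed
qed

section \<open>The equivalence of (i) to (vi)\<close>

theorem theorem1p6:
  fixes a b c d :: "'k::field"
    and i :: "'k \<Rightarrow> 'L::field"
    and t1 t2 t3 t4 :: 'L
  assumes inf: "infinite (UNIV :: 'k set)"
    and char: "(2::'k) \<noteq> 0"
    and not_ac: "\<exists>p :: 'k poly. degree p \<ge> 1 \<and> (\<forall>z. poly p z \<noteq> 0)"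
    and a_ns: "\<not> (\<exists>r. r\<^sup>2 = a)"
    and b_nz: "b \<noteq> 0"
    and cd: "c \<noteq> 0 \<or> d \<noteq> 0"
    and hom: "field_hom i"
    and gen: "gen_field (range i \<union> {t1, t2, t3, t4}) = UNIV"
    and trdeg: "trdeg_eq (range i) UNIV 2"
    and eq1: "t1\<^sup>2 - i a * t2\<^sup>2 = i b"
    and eq2: "t3\<^sup>2 - i a * t4\<^sup>2 = 2 * i c * t1 + i d"
    and b_ns: "\<not> (\<exists>r. r\<^sup>2 = b)"
  shows
   "(rational_over (range i) (UNIV :: 'L set)
      \<longleftrightarrow> (\<exists>m. rational_over (range (\<lambda>z. rf_const (i z) :: 'L ratfun)) (rf_field m :: 'L ratfun set)))
  \<and> ((\<exists>m. rational_over (range (\<lambda>z. rf_const (i z) :: 'L ratfun)) (rf_field m :: 'L ratfun set))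
      \<longleftrightarrow> (\<exists>n (f :: 'L \<Rightarrow> 'k ratfun). field_hom f \<and> inj f \<and> (\<forall>z. f (i z) = rf_const z)
              \<and> range f \<subseteq> rf_field n))
  \<and> ((\<exists>n (f :: 'L \<Rightarrow> 'k ratfun). field_hom f \<and> inj f \<and> (\<forall>z. f (i z) = rf_const z)
              \<and> range f \<subseteq> rf_field n)
      \<longleftrightarrow> (\<exists>\<alpha> \<beta> \<gamma> \<delta>. \<alpha>\<^sup>2 - a * \<beta>\<^sup>2 = b \<and> \<gamma>\<^sup>2 - a * \<delta>\<^sup>2 = 2 * c * \<alpha> + d))
  \<and> ((\<exists>\<alpha> \<beta> \<gamma> \<delta>. \<alpha>\<^sup>2 - a * \<beta>\<^sup>2 = b \<and> \<gamma>\<^sup>2 - a * \<delta>\<^sup>2 = 2 * c * \<alpha> + d)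
      \<longleftrightarrow> (\<exists>\<alpha> \<beta>. \<alpha>\<^sup>2 - a * \<beta>\<^sup>2 = b \<and>
             (- 2 * c * \<alpha> + d = 0 \<or>
              (- 2 * c * \<alpha> + d \<noteq> 0 \<and> hilbert_zero_sqrt (d\<^sup>2 - 4 * b * c\<^sup>2) a (- 2 * c * \<alpha> + d)))))
  \<and> ((\<exists>\<alpha> \<beta>. \<alpha>\<^sup>2 - a * \<beta>\<^sup>2 = b \<and>
             (- 2 * c * \<alpha> + d = 0 \<or>
              (- 2 * c * \<alpha> + d \<noteq> 0 \<and> hilbert_zero_sqrt (d\<^sup>2 - 4 * b * c\<^sup>2) a (- 2 * c * \<alpha> + d))))
      \<longleftrightarrow> (hilbert_zero a b \<and>
           (\<forall>\<alpha> \<beta>. \<alpha>\<^sup>2 - a * \<beta>\<^sup>2 = b \<longrightarrow>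
             (- 2 * c * \<alpha> + d = 0 \<or>
              (- 2 * c * \<alpha> + d \<noteq> 0 \<and> hilbert_zero_sqrt (d\<^sup>2 - 4 * b * c\<^sup>2) a (- 2 * c * \<alpha> + d))))))"
proof -
  let ?iv = "\<exists>\<alpha> \<beta> \<gamma> \<delta>. \<alpha>\<^sup>2 - a * \<beta>\<^sup>2 = b \<and> \<gamma>\<^sup>2 - a * \<delta>\<^sup>2 = 2 * c * \<alpha> + d"
  let ?H = "\<lambda>\<alpha>. - 2 * c * \<alpha> + d = 0 \<or>
    (- 2 * c * \<alpha> + d \<noteq> 0 \<and> hilbert_zero_sqrt (d\<^sup>2 - 4 * b * c\<^sup>2) a (- 2 * c * \<alpha> + d))"
  have H: "?iv \<longleftrightarrow> ?H \<alpha>" if "\<alpha>\<^sup>2 - a * \<beta>\<^sup>2 = b" for \<alpha> \<beta>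
    by (rule rational_point_iff_hilbert_zero_sqrt[OF a_ns char b_ns cd that])
  have i_ii: "\<exists>m. rational_over (range (\<lambda>z. rf_const (i z) :: 'L ratfun)) (rf_field m :: 'L ratfun set)"
    if "rational_over (range i) (UNIV :: 'L set)"
    using rational_over_imp_rf_field_0[OF hom that] by blast
  have ii_iii: "\<exists>n (f :: 'L \<Rightarrow> 'k ratfun). field_hom f \<and> inj f \<and> (\<forall>z. f (i z) = rf_const z)
              \<and> range f \<subseteq> rf_field n"
    if "\<exists>m. rational_over (range (\<lambda>z. rf_const (i z) :: 'L ratfun)) (rf_field m :: 'L ratfun set)"
    using that stably_rational_imp_unirational[OF hom] by (elim exE)
  have iii_iv: ?iv
    if "\<exists>n (f :: 'L \<Rightarrow> 'k ratfun). field_hom f \<and> inj f \<and> (\<forall>z. f (i z) = rf_const z)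
              \<and> range f \<subseteq> rf_field n"
  proof -
    from that obtain n and f :: "'L \<Rightarrow> 'k ratfun" where
      "field_hom f \<and> inj f \<and> (\<forall>z. f (i z) = rf_const z) \<and> range f \<subseteq> rf_field n" by (elim exE)
    hence f: "field_hom f" and fi: "\<And>z. f (i z) = rf_const z" by simp_all
    note homs = field_hom_add[OF f] field_hom_diff[OF f] field_hom_mult[OF f] field_hom_power[OF f]
      field_hom_numeral[OF f] fi
    from eq1 have "f (t1\<^sup>2 - i a * t2\<^sup>2) = f (i b)" by (rule arg_cong)
    moreover from eq2 have "f (t3\<^sup>2 - i a * t4\<^sup>2) = f (2 * i c * t1 + i d)" by (rule arg_cong)
    ultimately show ?iv
      unfolding homs by (rule specialize_conic_pair[OF inf])
  qed
  have iv_i: "rational_over (range i) (UNIV :: 'L set)" if ?iv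
    using that rational_over_of_rational_point[OF char a_ns b_ns cd hom gen trdeg eq1 eq2] by blast
  have v: "(\<exists>\<alpha> \<beta>. \<alpha>\<^sup>2 - a * \<beta>\<^sup>2 = b \<and> ?H \<alpha>) \<longleftrightarrow> ?iv"
    using H by blast
  \<comment> \<open>The vanishing of (a, b) supplies a point of the conic, so the universal
    condition is not vacuous and \<open>H\<close> applies.\<close>
  have vi: "(hilbert_zero a b \<and> (\<forall>\<alpha> \<beta>. \<alpha>\<^sup>2 - a * \<beta>\<^sup>2 = b \<longrightarrow> ?H \<alpha>)) \<longleftrightarrow> ?iv"
    unfolding hilbert_zero_iff[OF a_ns char b_nz] using H by blast
  from i_ii ii_iii iii_iv iv_i show ?thesis
    unfolding v vi by argo
qed

end
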